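(* For fields obeying the new boundary conditions (recalled in the context) at every time, the coefficient of the logarithmically divergent part of the kinetic term vanishes: $$\oint d^2x\,\big(\bar\pi^{rr}\,\dot{\bar h}_{rr}+\bar\pi^{AB}\,\dot{\bar h}_{AB}\big)=\oint d^2x\,\big(\bar p\,\dot{\bar\lambda}+2\,\bar\pi^{AB}\,\dot{\bar k}_{AB}\big)=0,$$ so that the kinetic term $\int d^3x\,\pi^{ij}\dot g_{ij}$ (and hence the symplectic form) is finite.
   Context: $g_{ij}$ is a time-dependent Riemannian metric on a 3-dimensional spatial slice and $\pi^{ij}$ its conjugate momentum, a symmetric tensor density of weight one; a dot denotes time derivative. Finiteness refers to convergence of the integral at spatial infinity, integrated over spheres first and then over $r$. Near infinity one uses coordinates $(r,x^A)$, $r\to\infty$, $x^A$ coordinates on the unit sphere. $\bar\gamma_{AB}$ is the unit round metric. Barred quantities and quantities with superscript $(2)$ are fields on the sphere (depending on time), with indices moved with $\bar\gamma$. Asymptotic expansions may be differentiated term by term. **New boundary conditions.** (1) Fall-off as $r\to\infty$: $g_{rr}=1+\frac1r\bar h_{rr}+\frac1{r^2}h^{(2)}_{rr}+o(r^{-2})$, $g_{rA}=\frac1rh^{(2)}_{rA}+o(r^{-1})$, $g_{AB}=r^2\bar\gamma_{AB}+r\bar h_{AB}+h^{(2)}_{AB}+o(1)$, $\pi^{rr}=\bar\pi^{rr}+\frac1r\pi^{(2)rr}+o(r^{-1})$, $\pi^{rA}=\frac1r\bar\pi^{rA}+\frac1{r^2}\pi^{(2)rA}+o(r^{-2})$, $\pi^{AB}=\frac1{r^2}\bar\pi^{AB}+\frac1{r^3}\pi^{(2)AB}+o(r^{-3})$.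 (2) Constraint fall-off: $\mathcal H=o(r^{-1})$, $\mathcal H_r=o(r^{-1})$, $\mathcal H_A=o(1)$, where $\mathcal H=-\sqrt g\,R+\frac1{\sqrt g}(\pi^{ij}\pi_{ij}-\frac12\pi^2)$, $\mathcal H_i=-2\pi_i{}^j{}_{|j}$ ($|$: covariant derivative of $g$, $R$ its scalar curvature, $\pi=g_{ij}\pi^{ij}$). (3) Parity: with $\bar\lambda=\frac12\bar h_{rr}$, $\bar k_{AB}=\frac12\bar h_{AB}+\bar\lambda\bar\gamma_{AB}$, $\bar p=2(\bar\pi^{rr}-\bar\pi^A{}_A)$, one requires $\bar\lambda,\bar\pi^{AB}$ even and $\bar p,\bar k_{AB},\bar\pi^{rA}$ odd. Here parity refers to components in sphere coordinates in which the antipodal map is $x^A\to-x^A$; equivalently, under pullback by the antipodal map (as tensors/densities transforming with the absolute value of the Jacobian) $\bar\lambda,\bar\pi^{AB},\bar\pi^{rA}$ are invariant and $\bar p,\bar k_{AB}$ change sign. *)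

theory Defs
  imports "HOL-Analysis.Analysis"
begin

section \<open>Partial derivatives and smoothness\<close>

definition partial :: "'a::real_normed_vector \<Rightarrow> ('a \<Rightarrow> 'b::real_normed_vector) \<Rightarrow> 'a \<Rightarrow> 'b" where
  "partial b f z = frechet_derivative f (at z) b"

primrec iter_partial :: "'a::real_normed_vector list \<Rightarrow> ('a \<Rightarrow> 'b::real_normed_vector) \<Rightarrow> 'a \<Rightarrow> 'b" where
  "iter_partial [] f = f"
| "iter_partial (b # bs) f = partial b (iter_partial bs f)"

definition smooth_on :: "'a::euclidean_space set \<Rightarrow> ('a \<Rightarrow> 'b::real_normed_vector) \<Rightarrow> bool" where
  "smooth_on S f \<longleftrightarrow>
     (\<forall>bs. set bs \<subseteq> Basis \<longrightarrow> (\<forall>z\<in>S. iter_partial bs f differentiable (at z)))"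


section \<open>Constraints in an arbitrary coordinate system\<close>

text \<open>
  A field on a coordinate domain is given by its components as a function of the coordinates
  in \<open>real^'n\<close>; \<open>\<pi>\<close> has upper indices and density weight one.
\<close>

type_synonym 'n coord_tensor = "real^'n \<Rightarrow> real^'n^'n"

definition christoffel :: "'n::finite coord_tensor \<Rightarrow> 'n \<Rightarrow> 'n \<Rightarrow> 'n \<Rightarrow> real^'n \<Rightarrow> real" where
  "christoffel g k i j y = (1/2) * (\<Sum>l\<in>UNIV. matrix_inv (g y) $ k $ l *
     (partial (axis i 1) (\<lambda>z. g z $ l $ j) y
      + partial (axis j 1) (\<lambda>z. g z $ l $ i) y
      - partial (axis l 1) (\<lambda>z. g z $ i $ j) y))"

definition ricci :: "'n::finite coord_tensor \<Rightarrow> 'n \<Rightarrow> 'n \<Rightarrow> real^'n \<Rightarrow> real" where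
  "ricci g i j y =
     (\<Sum>k\<in>UNIV. partial (axis k 1) (christoffel g k i j) y - partial (axis j 1) (christoffel g k i k) y
        + (\<Sum>l\<in>UNIV. christoffel g k k l y * christoffel g l i j y
                   - christoffel g k j l y * christoffel g l i k y))"

definition scalar_curvature :: "'n::finite coord_tensor \<Rightarrow> real^'n \<Rightarrow> real" where
  "scalar_curvature g y = (\<Sum>i\<in>UNIV. \<Sum>j\<in>UNIV. matrix_inv (g y) $ i $ j * ricci g i j y)"

text \<open>Components of \<open>\<nabla>\<^sub>k \<pi>\<^sup>i\<^sup>j\<close>; the last term is the weight-one contribution.\<close>

definition cov_deriv_density :: "'n::finite coord_tensor \<Rightarrow> 'n coord_tensor \<Rightarrow> 'n \<Rightarrow> 'n \<Rightarrow> 'n \<Rightarrow> real^'n \<Rightarrow> real" where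
  "cov_deriv_density g \<pi> k i j y = partial (axis k 1) (\<lambda>z. \<pi> z $ i $ j) y
     + (\<Sum>l\<in>UNIV. christoffel g i k l y * \<pi> y $ l $ j + christoffel g j k l y * \<pi> y $ i $ l)
     - (\<Sum>l\<in>UNIV. christoffel g l l k y) * \<pi> y $ i $ j"

definition hamiltonian_constraint :: "'n::finite coord_tensor \<Rightarrow> 'n coord_tensor \<Rightarrow> real^'n \<Rightarrow> real" where
  "hamiltonian_constraint g \<pi> y =
     - sqrt (det (g y)) * scalar_curvature g y
     + 1 / sqrt (det (g y)) *
        ((\<Sum>i\<in>UNIV. \<Sum>j\<in>UNIV. \<Sum>k\<in>UNIV. \<Sum>l\<in>UNIV. g y $ i $ k * g y $ j $ l * \<pi> y $ i $ j * \<pi> y $ k $ l)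
         - (1/2) * (\<Sum>i\<in>UNIV. \<Sum>j\<in>UNIV. g y $ i $ j * \<pi> y $ i $ j)\<^sup>2)"

definition momentum_constraint :: "'n::finite coord_tensor \<Rightarrow> 'n coord_tensor \<Rightarrow> 'n \<Rightarrow> real^'n \<Rightarrow> real" where
  "momentum_constraint g \<pi> i y =
     - 2 * (\<Sum>j\<in>UNIV. \<Sum>k\<in>UNIV. g y $ i $ k * cov_deriv_density g \<pi> j k j y)"


section \<open>Sphere coordinates\<close>

text \<open>
  The unit sphere carries the atlas of the two stereographic charts below, in which the antipodal
  map is \<open>x\<^sup>A \<mapsto> - x\<^sup>A\<close> followed by exchange of the charts (\<open>stereo_antipodal\<close>). The chart domain
  \<open>real^2\<close> covers the sphere minus one pole, and the two closed unit discs cover the two closed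
  hemispheres.
\<close>

datatype chart = North | South

primrec opposite :: "chart \<Rightarrow> chart" where
  "opposite North = South"
| "opposite South = North"

primrec pole_sign :: "chart \<Rightarrow> real" where
  "pole_sign North = 1"
| "pole_sign South = - 1"

definition stereo :: "chart \<Rightarrow> real^2 \<Rightarrow> real^3" where
  "stereo c x = (1 / (1 + (norm x)\<^sup>2)) *\<^sub>R
     vector [2 * x $ 1, 2 * x $ 2, pole_sign c * (1 - (norm x)\<^sup>2)]"

definition inversion :: "real^2 \<Rightarrow> real^2" where
  "inversion x = (1 / (norm x)\<^sup>2) *\<^sub>R x"

lemma stereo_antipodal: "stereo (opposite c) (- x) = - stereo c x"
  by (cases c) (simp_all add: stereo_def vec_eq_iff forall_3 vector_3 diff_divide_distrib)

lemma stereo_overlap: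
  assumes "x \<noteq> 0"
  shows "stereo (opposite c) (inversion x) = stereo c x"
proof -
  define a where "a = (norm x)\<^sup>2"
  have a: "a > 0"
    using assms by (simp add: a_def)
  have n: "(norm (inversion x))\<^sup>2 = 1 / a"
    using assms by (simp add: inversion_def power_divide power2_eq_square a_def)
  have e: "1 / (1 + 1 / a) = a / (1 + a)"
    using a by (simp add: divide_simps)
  have "stereo (opposite c) (inversion x) = (a / (1 + a)) *\<^sub>R
      vector [2 * (x $ 1 / a), 2 * (x $ 2 / a), - pole_sign c * (1 - 1 / a)]"
    unfolding stereo_def n e by (cases c) (simp_all add: inversion_def a_def)
  also have "\<dots> = stereo c x"
    using a unfolding stereo_def a_def[symmetric]
    by (cases c) (simp_all add: vec_eq_iff forall_3 vector_3 divide_simps)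
  finally show ?thesis .
qed

definition round_metric :: "chart \<Rightarrow> real^2 \<Rightarrow> real^2^2" where
  "round_metric c x =
     (\<chi> A B. partial (axis A 1) (stereo c) x \<bullet> partial (axis B 1) (stereo c) x)"

text \<open>
  Integral of a density of weight one on the sphere, given by its components in the two charts
  (the equator is a null set).
\<close>

definition sphere_integral :: "(chart \<Rightarrow> real^2 \<Rightarrow> real) \<Rightarrow> real" where
  "sphere_integral f = integral (cball 0 1) (f North) + integral (cball 0 1) (f South)"

definition sphere_integrable :: "(chart \<Rightarrow> real^2 \<Rightarrow> real) \<Rightarrow> bool" where
  "sphere_integrable f \<longleftrightarrow> (\<forall>c. f c absolutely_integrable_on cball 0 1)"


section \<open>Coordinates near infinity\<close>

text \<open>
  Spatial indices are of type \<open>2 option\<close>: \<open>None\<close> is the radial index and \<open>Some A\<close> is the sphere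
  index \<open>A\<close>.
\<close>

type_synonym idx = "2 option"

definition pt :: "real \<Rightarrow> real^2 \<Rightarrow> real^idx" where
  "pt r x = (\<chi> i. case i of None \<Rightarrow> r | Some A \<Rightarrow> x $ A)"

definition rad :: "real^idx \<Rightarrow> real" where
  "rad y = y $ None"

definition ang :: "real^idx \<Rightarrow> real^2" where
  "ang y = (\<chi> A. y $ Some A)"

definition transition :: "real^idx \<Rightarrow> real^idx" where
  "transition y = pt (rad y) (inversion (ang y))"

definition transition_jacobian :: "real^idx \<Rightarrow> real^idx^idx" where
  "transition_jacobian y = matrix (frechet_derivative transition (at y))"

text \<open>
  A time-dependent metric with its conjugate momentum near infinity: components in each chart as
  functions of time and of \<open>(r, x\<^sup>A)\<close>.
\<close>

record fields =
  metric :: "chart \<Rightarrow> real \<Rightarrow> real^idx \<Rightarrow> real^idx^idx"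
  momentum :: "chart \<Rightarrow> real \<Rightarrow> real^idx \<Rightarrow> real^idx^idx"

definition is_field_history :: "real \<Rightarrow> real set \<Rightarrow> fields \<Rightarrow> bool" where
  "is_field_history R0 T F \<longleftrightarrow>
     (\<forall>c i j. smooth_on (T \<times> {y. R0 < rad y}) (\<lambda>(t, y). metric F c t y $ i $ j)
            \<and> smooth_on (T \<times> {y. R0 < rad y}) (\<lambda>(t, y). momentum F c t y $ i $ j)) \<and>
     (\<forall>c. \<forall>t\<in>T. \<forall>y. R0 < rad y \<longrightarrow>
        transpose (metric F c t y) = metric F c t y \<and>
        (\<forall>v. v \<noteq> 0 \<longrightarrow> 0 < v \<bullet> (metric F c t y *v v)) \<and>
        transpose (momentum F c t y) = momentum F c t y) \<and>
     (\<forall>c. \<forall>t\<in>T. \<forall>y. R0 < rad y \<and> ang y \<noteq> 0 \<longrightarrow>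
        (let D = transition_jacobian y in
           metric F c t y = transpose D ** metric F (opposite c) t (transition y) ** D \<and>
           \<bar>det D\<bar> *\<^sub>R momentum F (opposite c) t (transition y) = D ** momentum F c t y ** transpose D))"


section \<open>Boundary conditions\<close>

text \<open>
  Coefficients of the asymptotic expansions, by their components in each chart. A suffix \<open>b\<close>
  stands for a bar, a suffix \<open>2\<close> for the superscript \<open>(2)\<close>. They are determined by the fields.
\<close>

record coeffs =
  hrr_b :: "chart \<Rightarrow> real \<Rightarrow> real^2 \<Rightarrow> real"
  hrr_2 :: "chart \<Rightarrow> real \<Rightarrow> real^2 \<Rightarrow> real"
  hrA_2 :: "chart \<Rightarrow> real \<Rightarrow> real^2 \<Rightarrow> real^2"
  hAB_b :: "chart \<Rightarrow> real \<Rightarrow> real^2 \<Rightarrow> real^2^2"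
  hAB_2 :: "chart \<Rightarrow> real \<Rightarrow> real^2 \<Rightarrow> real^2^2"
  \<pi>rr_b :: "chart \<Rightarrow> real \<Rightarrow> real^2 \<Rightarrow> real"
  \<pi>rr_2 :: "chart \<Rightarrow> real \<Rightarrow> real^2 \<Rightarrow> real"
  \<pi>rA_b :: "chart \<Rightarrow> real \<Rightarrow> real^2 \<Rightarrow> real^2"
  \<pi>rA_2 :: "chart \<Rightarrow> real \<Rightarrow> real^2 \<Rightarrow> real^2"
  \<pi>AB_b :: "chart \<Rightarrow> real \<Rightarrow> real^2 \<Rightarrow> real^2^2"
  \<pi>AB_2 :: "chart \<Rightarrow> real \<Rightarrow> real^2 \<Rightarrow> real^2^2"

definition coeffs_smooth :: "real set \<Rightarrow> coeffs \<Rightarrow> bool" where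
  "coeffs_smooth T C \<longleftrightarrow>
     (\<forall>c. \<forall>f \<in> {hrr_b C, hrr_2 C, \<pi>rr_b C, \<pi>rr_2 C}. smooth_on (T \<times> UNIV) (\<lambda>(t, x). f c t x)) \<and>
     (\<forall>c A. \<forall>f \<in> {hrA_2 C, \<pi>rA_b C, \<pi>rA_2 C}. smooth_on (T \<times> UNIV) (\<lambda>(t, x). f c t x $ A)) \<and>
     (\<forall>c A B. \<forall>f \<in> {hAB_b C, hAB_2 C, \<pi>AB_b C, \<pi>AB_2 C}. smooth_on (T \<times> UNIV) (\<lambda>(t, x). f c t x $ A $ B))"

definition small_o :: "nat \<Rightarrow> (chart \<Rightarrow> real^idx \<Rightarrow> real) \<Rightarrow> bool" where
  "small_o n f \<longleftrightarrow>
     (\<forall>c K. compact K \<longrightarrow> uniform_limit K (\<lambda>r x. r ^ n * f c (pt r x)) (\<lambda>_. 0) at_top)"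

text \<open>
  \<open>f = e + o(r\<^sup>-\<^sup>n)\<close> on \<open>T\<close>, differentiable term by term: every derivative of the remainder with
  respect to \<open>t\<close>, \<open>r\<close>, \<open>x\<^sup>A\<close> obeys the differentiated estimate, each \<open>\<partial>\<^sub>r\<close> gaining a power of \<open>1/r\<close>.
\<close>

definition has_expansion ::
  "real set \<Rightarrow> nat \<Rightarrow> (chart \<Rightarrow> real \<Rightarrow> real^idx \<Rightarrow> real) \<Rightarrow>
   (chart \<Rightarrow> real \<Rightarrow> real \<Rightarrow> real^2 \<Rightarrow> real) \<Rightarrow> bool" where
  "has_expansion T n f e \<longleftrightarrow>
     (\<forall>ds. \<forall>t\<in>T. set ds \<subseteq> Basis \<longrightarrow>
        small_o (n + count_list ds (0, axis None 1))
          (\<lambda>c y. iter_partial ds (\<lambda>(s, z). f c s z - e c s (rad z) (ang z)) (t, y)))"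

definition field_falloff :: "real set \<Rightarrow> fields \<Rightarrow> coeffs \<Rightarrow> bool" where
  "field_falloff T F C \<longleftrightarrow>
     has_expansion T 2 (\<lambda>c t y. metric F c t y $ None $ None)
       (\<lambda>c t r x. 1 + hrr_b C c t x / r + hrr_2 C c t x / r^2) \<and>
     (\<forall>A. has_expansion T 1 (\<lambda>c t y. metric F c t y $ None $ Some A)
       (\<lambda>c t r x. hrA_2 C c t x $ A / r)) \<and>
     (\<forall>A B. has_expansion T 0 (\<lambda>c t y. metric F c t y $ Some A $ Some B)
       (\<lambda>c t r x. r^2 * round_metric c x $ A $ B + r * hAB_b C c t x $ A $ B + hAB_2 C c t x $ A $ B)) \<and>
     has_expansion T 1 (\<lambda>c t y. momentum F c t y $ None $ None)
       (\<lambda>c t r x. \<pi>rr_b C c t x + \<pi>rr_2 C c t x / r) \<and>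
     (\<forall>A. has_expansion T 2 (\<lambda>c t y. momentum F c t y $ None $ Some A)
       (\<lambda>c t r x. \<pi>rA_b C c t x $ A / r + \<pi>rA_2 C c t x $ A / r^2)) \<and>
     (\<forall>A B. has_expansion T 3 (\<lambda>c t y. momentum F c t y $ Some A $ Some B)
       (\<lambda>c t r x. \<pi>AB_b C c t x $ A $ B / r^2 + \<pi>AB_2 C c t x $ A $ B / r^3))"

definition constraint_falloff :: "real set \<Rightarrow> fields \<Rightarrow> bool" where
  "constraint_falloff T F \<longleftrightarrow>
     (\<forall>t\<in>T. small_o 1 (\<lambda>c. hamiltonian_constraint (metric F c t) (momentum F c t)) \<and>
            small_o 1 (\<lambda>c. momentum_constraint (metric F c t) (momentum F c t) None) \<and>
            (\<forall>A. small_o 0 (\<lambda>c. momentum_constraint (metric F c t) (momentum F c t) (Some A))))"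

definition lambda_b :: "coeffs \<Rightarrow> chart \<Rightarrow> real \<Rightarrow> real^2 \<Rightarrow> real" where
  "lambda_b C c t x = (1/2) * hrr_b C c t x"

definition k_b :: "coeffs \<Rightarrow> chart \<Rightarrow> real \<Rightarrow> real^2 \<Rightarrow> real^2^2" where
  "k_b C c t x = (1/2) *\<^sub>R hAB_b C c t x + lambda_b C c t x *\<^sub>R round_metric c x"

definition p_b :: "coeffs \<Rightarrow> chart \<Rightarrow> real \<Rightarrow> real^2 \<Rightarrow> real" where
  "p_b C c t x =
     2 * (\<pi>rr_b C c t x - (\<Sum>A\<in>UNIV. \<Sum>B\<in>UNIV. round_metric c x $ A $ B * \<pi>AB_b C c t x $ A $ B))"

definition even_components :: "(chart \<Rightarrow> real^2 \<Rightarrow> 'b) \<Rightarrow> bool" where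
  "even_components f \<longleftrightarrow> (\<forall>c x. f (opposite c) (- x) = f c x)"

definition odd_components :: "(chart \<Rightarrow> real^2 \<Rightarrow> 'b::uminus) \<Rightarrow> bool" where
  "odd_components f \<longleftrightarrow> (\<forall>c x. f (opposite c) (- x) = - f c x)"

definition parity_conditions :: "real set \<Rightarrow> coeffs \<Rightarrow> bool" where
  "parity_conditions T C \<longleftrightarrow>
     (\<forall>t\<in>T. even_components (\<lambda>c. lambda_b C c t) \<and>
            even_components (\<lambda>c. \<pi>AB_b C c t) \<and>
            odd_components (\<lambda>c. p_b C c t) \<and>
            odd_components (\<lambda>c. k_b C c t) \<and>
            odd_components (\<lambda>c. \<pi>rA_b C c t))"

definition new_boundary_conditions :: "real \<Rightarrow> real set \<Rightarrow> fields \<Rightarrow> coeffs \<Rightarrow> bool" where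
  "new_boundary_conditions R0 T F C \<longleftrightarrow>
     is_field_history R0 T F \<and> coeffs_smooth T C \<and>
     field_falloff T F C \<and> constraint_falloff T F \<and> parity_conditions T C"


section \<open>Kinetic term and symplectic form\<close>

definition kinetic_density :: "fields \<Rightarrow> real \<Rightarrow> real \<Rightarrow> chart \<Rightarrow> real^2 \<Rightarrow> real" where
  "kinetic_density F t r c x =
     (\<Sum>i\<in>UNIV. \<Sum>j\<in>UNIV.
        momentum F c t (pt r x) $ i $ j * deriv (\<lambda>s. metric F c s (pt r x) $ i $ j) t)"

text \<open>
  The integrand of the canonical symplectic form on the two tangent vectors that are the velocities
  at \<open>t\<close> of two curves \<open>F\<close>, \<open>G\<close> in phase space through the same point.
\<close>

definition symplectic_density :: "fields \<Rightarrow> fields \<Rightarrow> real \<Rightarrow> real \<Rightarrow> chart \<Rightarrow> real^2 \<Rightarrow> real" where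
  "symplectic_density F G t r c x =
     (\<Sum>i\<in>UNIV. \<Sum>j\<in>UNIV.
        deriv (\<lambda>s. momentum F c s (pt r x) $ i $ j) t * deriv (\<lambda>s. metric G c s (pt r x) $ i $ j) t
      - deriv (\<lambda>s. momentum G c s (pt r x) $ i $ j) t * deriv (\<lambda>s. metric F c s (pt r x) $ i $ j) t)"

definition agree_at :: "real \<Rightarrow> real \<Rightarrow> fields \<Rightarrow> fields \<Rightarrow> bool" where
  "agree_at R0 t F G \<longleftrightarrow>
     (\<forall>c y. R0 < rad y \<longrightarrow> metric F c t y = metric G c t y \<and> momentum F c t y = momentum G c t y)"

text \<open>
  The integral of \<open>f\<close> over \<open>R1 < r < R\<close> (spheres first) is \<open>a * ln R\<close> plus a convergent
  quantity.
\<close>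

definition log_divergence :: "real \<Rightarrow> (real \<Rightarrow> chart \<Rightarrow> real^2 \<Rightarrow> real) \<Rightarrow> real \<Rightarrow> bool" where
  "log_divergence R0 f a \<longleftrightarrow>
     (\<forall>R1>R0. \<exists>L.
        ((\<lambda>R. integral {R1..R} (\<lambda>r. sphere_integral (f r)) - a * ln R) \<longlongrightarrow> L) at_top)"

definition finite_at_infinity :: "real \<Rightarrow> (real \<Rightarrow> chart \<Rightarrow> real^2 \<Rightarrow> real) \<Rightarrow> bool" where
  "finite_at_infinity R0 f \<longleftrightarrow>
     (\<forall>r>R0. sphere_integrable (f r)) \<and>
     (\<forall>R1>R0.
        (\<forall>R\<ge>R1. (\<lambda>r. sphere_integral (f r)) absolutely_integrable_on {R1..R}) \<and>
        (\<exists>L. ((\<lambda>R. integral {R1..R} (\<lambda>r. sphere_integral (f r))) \<longlongrightarrow> L) at_top))"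

definition log_coeff_density :: "coeffs \<Rightarrow> real \<Rightarrow> chart \<Rightarrow> real^2 \<Rightarrow> real" where
  "log_coeff_density C t c x =
     \<pi>rr_b C c t x * deriv (\<lambda>s. hrr_b C c s x) t
     + (\<Sum>A\<in>UNIV. \<Sum>B\<in>UNIV. \<pi>AB_b C c t x $ A $ B * deriv (\<lambda>s. hAB_b C c s x $ A $ B) t)"

definition log_coeff_density' :: "coeffs \<Rightarrow> real \<Rightarrow> chart \<Rightarrow> real^2 \<Rightarrow> real" where
  "log_coeff_density' C t c x =
     p_b C c t x * deriv (\<lambda>s. lambda_b C c s x) t
     + 2 * (\<Sum>A\<in>UNIV. \<Sum>B\<in>UNIV. \<pi>AB_b C c t x $ A $ B * deriv (\<lambda>s. k_b C c s x $ A $ B) t)"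

end

(*
  Each component of the metric and of the momentum has a remainder o(r^-n) and a leading
  time-dependent term of order r^(1-n), with the two exponents n of conjugate components adding up
  to 3. Hence every product of a momentum component and a metric velocity is a coefficient times
  1/r plus O(r^-2), and only that coefficient can produce a logarithm. Written in terms of p,
  lambda, pi^AB and k_AB, it pairs an even with an odd factor, so it is odd under the antipodal
  map and its integral over the sphere vanishes. Parity is preserved by time derivatives, so the
  same argument applies to the symplectic form, whose two arguments are velocities.
*)

theory Submission
  imports Defs
begin

section \<open>Integration over the sphere and at infinity\<close>

text \<open>Two orders of every expansion enter. A leading coefficient alone leaves a relative error
  o(1), so products would be known only up to o(1/r), which need not be integrable at infinity. The
  superscript (2) terms improve the relative error to O(1/r), and after division by r the error is
  integrable. The estimates are uniform on the closed unit disc of each stereographic chart, so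
  passing to the sphere integral only costs the area of the disc. The static terms 1 and r^2 times
  the round metric dominate the terms of interest and disappear only under the time derivative. The
  expansion hypothesis bounds a partial derivative defined through the Frechet derivative of the
  whole remainder in time and space; splitting it into the velocity of the field minus that of the
  expansion requires the subtracted expansion to be jointly differentiable. This is the origin of
  the explicit derivative of the stereographic charts.\<close>

lemma has_integral_reflect_cball:
  fixes f :: "'a::euclidean_space \<Rightarrow> 'b::banach"
  shows "((\<lambda>x. f (- x)) has_integral y) (cball 0 e) \<longleftrightarrow> (f has_integral y) (cball 0 e)"
proof -
  \<comment> \<open>Reflection turns the box with corners a, b into the one with corners -b, -a. A
    box symmetric about 0 is thus preserved, and extension by zero outside the ball commutes with
    reflection because the ball is symmetric.\<close>
  obtain b where b: "cball (0::'a) e \<subseteq> cbox (- b) b"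
    using bounded_subset_cbox_symmetric bounded_cball by blast
  define g where "g = (\<lambda>x. if x \<in> cball 0 e then f x else 0)"
  have "((\<lambda>x. f (- x)) has_integral y) (cball 0 e) \<longleftrightarrow> ((\<lambda>x. g (- x)) has_integral y) (cbox (- b) b)"
    using has_integral_restrict[OF b, of "\<lambda>x. f (- x)" y] by (simp add: g_def cong: if_cong)
  also have "\<dots> \<longleftrightarrow> (g has_integral y) (cbox (- b) b)"
    using has_integral_reflect[of g y b "- b"] by simp
  also have "\<dots> \<longleftrightarrow> (f has_integral y) (cball 0 e)"
    using has_integral_restrict[OF b, of f y] by (simp add: g_def cong: if_cong)
  finally show ?thesis .
qed

lemma integral_reflect_cball:
  fixes f :: "'a::euclidean_space \<Rightarrow> 'b::banach"
  shows "integral (cball 0 e) (\<lambda>x. f (- x)) = integral (cball 0 e) f"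
  unfolding integral_def integrable_on_def has_integral_reflect_cball ..

text \<open>The antipodal map is x to -x followed by exchange of the charts, so it carries the
  northern disc to the southern one. Its Jacobian has absolute value 1, and the two hemisphere
  integrals cancel.\<close>

lemma sphere_integral_odd:
  assumes "odd_components f"
  shows "sphere_integral f = 0"
proof -
  have "f South = (\<lambda>x. - f North (- x))"
    using assms unfolding odd_components_def by (metis minus_minus opposite.simps(1))
  then show ?thesis
    by (simp add: sphere_integral_def integral_reflect_cball)
qed

section \<open>Integrals of continuous functions over compact sets and half-lines\<close>

lemma continuous_on_compact_abs_bounded:
  fixes f :: "'a::topological_space \<Rightarrow> real"
  assumes "continuous_on K f" "compact K"
  shows "\<exists>B. \<forall>x\<in>K. \<bar>f x\<bar> \<le> B"
  using compact_imp_bounded[OF compact_continuous_image[OF assms]] by (simp add: bounded_real)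

lemma absolutely_integrable_continuous_compact:
  fixes f :: "'a::euclidean_space \<Rightarrow> 'b::euclidean_space"
  assumes "continuous_on S f" "compact S"
  shows "f absolutely_integrable_on S"
proof -
  obtain B where "\<And>x. x \<in> S \<Longrightarrow> norm (f x) \<le> B"
    using assms by (metis bounded_iff compact_continuous_image compact_imp_bounded imageI)
  moreover have "f \<in> borel_measurable (lebesgue_on S)"
    using assms by (simp add: continuous_imp_measurable_on_sets_lebesgue fmeasurableD lmeasurable_compact)
  moreover have "(\<lambda>x. B) integrable_on S"
    using assms by (intro integrable_on_const lmeasurable_compact)
  ultimately show ?thesis
    using assms by (intro measurable_bounded_by_integrable_imp_absolutely_integrable[where g = "\<lambda>x. B"])
      (auto simp: fmeasurableD lmeasurable_compact)
qed

text \<open>Continuity is tested on sequences: a convergent sequence together with its limit is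
  compact, hence so is its product with K, and the integrand is bounded there by one constant that
  serves as dominating function.\<close>

lemma continuous_on_integral_compact_param:
  fixes f :: "'a::heine_borel \<Rightarrow> 'b::euclidean_space \<Rightarrow> real"
  assumes f: "continuous_on (U \<times> K) (\<lambda>(r, x). f r x)" and K: "compact K"
  shows "continuous_on U (\<lambda>r. integral K (f r))"
proof -
  have "(\<lambda>n. integral K (f (X n))) \<longlonglongrightarrow> integral K (f r)"
    if r: "r \<in> U" and X: "\<And>n. X n \<in> U" "X \<longlonglongrightarrow> r" for X r
  proof -
    have "compact (insert r (range X) \<times> K)"
      using compact_sequence_with_limit[OF X(2)] K by (rule compact_Times)
    moreover have "continuous_on (insert r (range X) \<times> K) (\<lambda>(r, x). f r x)"
      using r X by (intro continuous_on_subset[OF f]) auto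
    ultimately have "bounded ((\<lambda>(r, x). f r x) ` (insert r (range X) \<times> K))"
      by (blast intro: compact_imp_bounded compact_continuous_image)
    then obtain B where B: "\<forall>y \<in> (\<lambda>(r, x). f r x) ` (insert r (range X) \<times> K). \<bar>y\<bar> \<le> B"
      unfolding bounded_real by (rule exE)
    have slice: "continuous_on K (f s)" if "s \<in> U" for s
    proof -
      have "continuous_on K (\<lambda>x. case (s, x) of (s, x) \<Rightarrow> f s x)"
        by (rule continuous_on_compose2[OF f]) (use that in \<open>auto intro!: continuous_intros\<close>)
      then show ?thesis by simp
    qed
    show ?thesis
    proof (rule dominated_convergence(2))
      show "f (X n) integrable_on K" for n
        using slice X K absolutely_integrable_continuous_compact set_lebesgue_integral_eq_integral(1) by blast
      show "(\<lambda>x. B) integrable_on K"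
        using K by (intro integrable_on_const lmeasurable_compact)
      show "norm (f (X n) x) \<le> B" if "x \<in> K" for n x
        using B that by force
      show "(\<lambda>n. f (X n) x) \<longlonglongrightarrow> f r x" if "x \<in> K" for x
      proof -
        have "continuous_on U (\<lambda>s. case (s, x) of (s, x) \<Rightarrow> f s x)"
          by (rule continuous_on_compose2[OF f]) (use that in \<open>auto intro!: continuous_intros\<close>)
        then show ?thesis
          using r X by (simp add: continuous_on_sequentially o_def)
      qed
    qed
  qed
  then show ?thesis
    by (simp add: continuous_on_sequentially o_def)
qed

text \<open>The eventual bound extends to all r from a on after enlarging its constant, and N / r^2
  is integrable on \<open>{a..}\<close>; dominated convergence applies to the truncations of
  f.\<close>

lemma integral_converges_at_top:
  fixes f :: "real \<Rightarrow> real"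
  assumes f: "continuous_on {a..} f" and a: "0 < a"
    and bound: "\<forall>\<^sub>F r in at_top. \<bar>f r\<bar> \<le> M / r\<^sup>2"
  shows "\<exists>L. ((\<lambda>R. integral {a..R} f) \<longlongrightarrow> L) at_top"
proof -
  obtain b where b: "\<And>r. r \<ge> b \<Longrightarrow> \<bar>f r\<bar> \<le> M / r\<^sup>2"
    using bound by (auto simp: eventually_at_top_linorder)
  have "continuous_on {a..b} f"
    using f by (rule continuous_on_subset) auto
  from continuous_on_compact_abs_bounded[OF this compact_Icc]
  obtain B where B: "\<And>r. r \<in> {a..b} \<Longrightarrow> \<bar>f r\<bar> \<le> B"
    by blast
  \<comment> \<open>For r up to b, a bound B on the absolute value of f and r^2 \<le> b^2 give the
    second entry; beyond b the entry M suffices. \<open>max 0\<close> supplies the sign needed to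
    multiply the two inequalities.\<close>
  define N where "N = max M (max 0 B * b\<^sup>2)"
  have N: "\<bar>f r\<bar> \<le> N / r\<^sup>2" if "a \<le> r" for r
  proof (cases "r \<le> b")
    case True
    have "\<bar>f r\<bar> * r\<^sup>2 \<le> max 0 B * b\<^sup>2"
      using that True a B[of r] by (intro mult_mono power_mono) auto
    then show ?thesis
      using that a by (simp add: N_def pos_le_divide_eq)
  next
    case False
    have "\<bar>f r\<bar> \<le> M / r\<^sup>2" using b False by simp
    also have "\<dots> \<le> N / r\<^sup>2" by (intro divide_right_mono) (auto simp: N_def)
    finally show ?thesis .
  qed
  have h: "(\<lambda>r. N / r\<^sup>2) integrable_on {a..}"
    using has_integral_inverse_power_to_inf[of 2 a] a
    by (auto simp: integrable_on_def divide_inverse intro: has_integral_mult_right)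
  define L where "L = integral {a..} f"
  have "(\<lambda>n. integral {a..X n} f) \<longlonglongrightarrow> L" if X: "filterlim X at_top sequentially" for X :: "nat \<Rightarrow> real"
  proof -
    define g where "g = (\<lambda>n r. if r \<in> {a..X n} then f r else 0)"
    have i: "integral {a..} (g n) = integral {a..X n} f" for n
      unfolding g_def integral_restrict_Int Henstock_Kurzweil_Integration.integral_restrict_Int
      by (simp add: Int_absorb2 Icc_subset_Ici_iff)
    have "(\<lambda>n. integral {a..} (g n)) \<longlonglongrightarrow> integral {a..} f"
    proof (rule dominated_convergence)
      have "f integrable_on {a..X n}" for n
        using f by (intro integrable_continuous_real) (auto intro: continuous_on_subset)
      then show "g n integrable_on {a..}" for n
        unfolding g_def integrable_restrict_Int
        by (simp add: Int_absorb2 Icc_subset_Ici_iff)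
      show "norm (g n r) \<le> N / r\<^sup>2" if "r \<in> {a..}" for n r
        \<comment> \<open>Where the truncation is 0 the bound has to be nonnegative, which follows
          from its dominating an absolute value.\<close>
        using N[of r] that order_trans[OF abs_ge_zero N[of r]] by (auto simp: g_def)
      show "(\<lambda>n. g n r) \<longlonglongrightarrow> f r" if "r \<in> {a..}" for r
      proof (rule tendsto_eventually)
        have "\<forall>\<^sub>F n in sequentially. r \<le> X n"
          using X by (simp add: filterlim_at_top)
        then show "\<forall>\<^sub>F n in sequentially. g n r = f r"
          by eventually_elim (use that in \<open>auto simp: g_def\<close>)
      qed
    qed (rule h)
    then show ?thesis by (simp add: i L_def)
  qed
  then show ?thesis
    by (blast intro: tendsto_at_topI_sequentially)
qed

section \<open>Leading coefficients and the logarithm they produce\<close>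

lemma continuous_on_sphere_integral:
  assumes "\<And>c. continuous_on (U \<times> cball 0 1) (\<lambda>(r, x). f r c x)"
  shows "continuous_on U (\<lambda>r::real. sphere_integral (f r))"
  unfolding sphere_integral_def
  using assms by (intro continuous_intros continuous_on_integral_compact_param) auto

lemma sphere_integrable_continuous:
  assumes "\<And>c. continuous_on (cball 0 1) (f c)"
  shows "sphere_integrable f"
  unfolding sphere_integrable_def
  using assms absolutely_integrable_continuous_compact compact_cball by blast

text \<open>\<open>f = r\<^sup>1\<^sup>-\<^sup>n (a + O(1/r))\<close>, uniformly on each closed hemisphere.\<close>

definition has_leading :: "real \<Rightarrow> nat \<Rightarrow> (real \<Rightarrow> chart \<Rightarrow> real^2 \<Rightarrow> real) \<Rightarrow> (chart \<Rightarrow> real^2 \<Rightarrow> real) \<Rightarrow> bool" where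
  "has_leading R0 n f a \<longleftrightarrow>
     (\<forall>c. continuous_on ({R0<..} \<times> cball 0 1) (\<lambda>(r, x). f r c x) \<and> continuous_on (cball 0 1) (a c) \<and>
          (\<exists>M. \<forall>\<^sub>F r in at_top. \<forall>x\<in>cball 0 1. \<bar>r ^ n / r * f r c x - a c x\<bar> \<le> M / r))"

text \<open>Equality is required only beyond \<open>R0\<close> because the symmetry of the metric
  and the momentum, which this lemma exploits later, is known only there.\<close>

lemma has_leading_cong:
  assumes f: "has_leading R0 n f a" and eq: "\<And>r c x. R0 < r \<Longrightarrow> f r c x = g r c x"
  shows "has_leading R0 n g a"
  unfolding has_leading_def
proof (intro allI conjI)
  fix c
  have "continuous_on ({R0<..} \<times> cball 0 1) (\<lambda>(r, x). g r c x) \<longleftrightarrow>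
      continuous_on ({R0<..} \<times> cball 0 1) (\<lambda>(r, x). f r c x)"
    by (intro continuous_on_cong) (auto simp: eq)
  then show "continuous_on ({R0<..} \<times> cball 0 1) (\<lambda>(r, x). g r c x)"
    using f by (simp add: has_leading_def)
  show "continuous_on (cball 0 1) (a c)"
    using f by (simp add: has_leading_def)
  obtain M where "\<forall>\<^sub>F r in at_top. \<forall>x\<in>cball 0 1. \<bar>r ^ n / r * f r c x - a c x\<bar> \<le> M / r"
    using f by (auto simp: has_leading_def)
  then have "\<forall>\<^sub>F r in at_top. \<forall>x\<in>cball 0 1. \<bar>r ^ n / r * g r c x - a c x\<bar> \<le> M / r"
    using eventually_gt_at_top[of R0] by eventually_elim (simp add: eq)
  then show "\<exists>M. \<forall>\<^sub>F r in at_top. \<forall>x\<in>cball 0 1. \<bar>r ^ n / r * g r c x - a c x\<bar> \<le> M / r" ..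
qed

lemma has_leading_continuous_slice:
  assumes "has_leading R0 n f a" "R0 < r"
  shows "continuous_on (cball 0 1) (f r c)"
proof -
  have "continuous_on ({R0<..} \<times> cball 0 1) (\<lambda>(r, x). f r c x)"
    using assms by (simp add: has_leading_def)
  then have "continuous_on (cball 0 1) (\<lambda>x. case (r, x) of (r, x) \<Rightarrow> f r c x)"
    by (rule continuous_on_compose2) (use assms in \<open>auto intro!: continuous_intros\<close>)
  then show ?thesis by simp
qed

text \<open>For n = 2 the estimate compares r f with a up to M / r. Dividing by r bounds f - a / r
  by M / r^2 uniformly on a disc, and integration multiplies this by the area
  \<open>V\<close>.\<close>

lemma has_leading_sphere_integral:
  assumes lead: "has_leading R0 2 f a"
  shows "\<exists>M. \<forall>\<^sub>F r in at_top. \<bar>sphere_integral (f r) - sphere_integral a / r\<bar> \<le> M / r\<^sup>2"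
proof -
  have "\<forall>c. \<exists>M. \<forall>\<^sub>F r in at_top. \<forall>x\<in>cball 0 1. \<bar>r ^ 2 / r * f r c x - a c x\<bar> \<le> M / r"
    using lead by (simp add: has_leading_def)
  then obtain M where M: "\<And>c. \<forall>\<^sub>F r in at_top. \<forall>x\<in>cball 0 1. \<bar>r ^ 2 / r * f r c x - a c x\<bar> \<le> M c / r"
    using choice[where Q = "\<lambda>c M. \<forall>\<^sub>F r in at_top. \<forall>x\<in>cball 0 1. \<bar>r ^ 2 / r * f r c x - a c x\<bar> \<le> M / r"] by auto
  define V where "V = integral (cball (0::real^2) 1) (\<lambda>_. 1 :: real)"
  have "\<forall>\<^sub>F r in at_top. \<bar>integral (cball 0 1) (f r c) - integral (cball 0 1) (a c) / r\<bar> \<le> M c * V / r\<^sup>2" for c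
    using M[of c] eventually_gt_at_top[of 0] eventually_gt_at_top[of R0]
  proof eventually_elim
    case (elim r)
    have f: "f r c integrable_on cball 0 1"
      using has_leading_continuous_slice[OF lead elim(3)] absolutely_integrable_continuous_compact
        compact_cball set_lebesgue_integral_eq_integral(1) by blast
    have a: "a c integrable_on cball 0 1"
      using lead absolutely_integrable_continuous_compact compact_cball set_lebesgue_integral_eq_integral(1)
      unfolding has_leading_def by blast
    have eq: "integral (cball 0 1) (\<lambda>x. f r c x - a c x / r) = integral (cball 0 1) (f r c) - integral (cball 0 1) (a c) / r"
      using f a by (simp add: integral_diff integrable_on_divide)
    have "norm (integral (cball 0 1) (\<lambda>x. f r c x - a c x / r)) \<le> integral (cball (0::real^2) 1) (\<lambda>x. M c / r\<^sup>2)"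
    proof (rule Henstock_Kurzweil_Integration.integral_norm_bound_integral)
      show "(\<lambda>x. f r c x - a c x / r) integrable_on cball 0 1"
        using f a by (intro integrable_diff integrable_on_divide)
      show "(\<lambda>x. M c / r\<^sup>2) integrable_on cball (0::real^2) 1"
        by (intro integrable_on_const) auto
      fix x :: "real^2" assume x: "x \<in> cball 0 1"
      have "f r c x - a c x / r = (r ^ 2 / r * f r c x - a c x) / r"
        using elim(2) by (simp add: power2_eq_square diff_divide_distrib)
      then have "\<bar>f r c x - a c x / r\<bar> = \<bar>r ^ 2 / r * f r c x - a c x\<bar> / r"
        using elim(2) by (simp add: abs_divide)
      also have "\<dots> \<le> (M c / r) / r"
        using elim(1,2) x by (intro divide_right_mono) auto
      finally show "norm (f r c x - a c x / r) \<le> M c / r\<^sup>2"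
        by (simp add: power2_eq_square)
    qed
    also have "\<dots> = M c * V / r\<^sup>2"
      using integral_mult_right[of "cball (0::real^2) 1" "M c / r\<^sup>2" "\<lambda>_. 1"] by (simp add: V_def)
    finally show ?case by (simp add: eq)
  qed
  note * = this
  have "\<forall>\<^sub>F r in at_top. \<bar>sphere_integral (f r) - sphere_integral a / r\<bar> \<le> (M North * V + M South * V) / r\<^sup>2"
    using *[of North] *[of South]
    by eventually_elim (simp add: sphere_integral_def add_divide_distrib)
  then show ?thesis ..
qed

text \<open>Subtracting A / r from the sphere integral leaves a continuous function of size
  O(1/r^2), whose integral converges. The integral of A / r is A ln R - A ln R1; its second part is
  a constant absorbed into the limit.\<close>

lemma has_leading_log_divergence:
  assumes lead: "has_leading R0 2 f a" and R0: "0 < R0"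
  shows "log_divergence R0 f (sphere_integral a)"
  unfolding log_divergence_def
proof (intro allI impI)
  fix R1 assume R1: "R0 < R1"
  define A where "A = sphere_integral a"
  have cont: "continuous_on {R0<..} (\<lambda>r. sphere_integral (f r))"
    using lead by (intro continuous_on_sphere_integral) (auto simp: has_leading_def)
  obtain M where M: "\<forall>\<^sub>F r in at_top. \<bar>sphere_integral (f r) - A / r\<bar> \<le> M / r\<^sup>2"
    using has_leading_sphere_integral[OF lead] unfolding A_def by blast
  have "continuous_on {R1..} (\<lambda>r. sphere_integral (f r) - A / r)"
    using R0 R1 by (intro continuous_intros continuous_on_subset[OF cont]) auto
  then obtain L where L: "((\<lambda>R. integral {R1..R} (\<lambda>r. sphere_integral (f r) - A / r)) \<longlongrightarrow> L) at_top"
    using integral_converges_at_top M R0 R1 by (meson order_less_trans)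
  have "\<forall>\<^sub>F R in at_top. integral {R1..R} (\<lambda>r. sphere_integral (f r) - A / r) - A * ln R1
      = integral {R1..R} (\<lambda>r. sphere_integral (f r)) - A * ln R"
    using eventually_ge_at_top[of R1]
  proof eventually_elim
    case (elim R)
    have "((\<lambda>r. A / r) has_integral A * ln R - A * ln R1) {R1..R}"
      by (rule fundamental_theorem_of_calculus[OF elim])
         (use R0 R1 in \<open>auto intro!: derivative_eq_intros simp flip: has_real_derivative_iff_has_vector_derivative\<close>)
    moreover have "((\<lambda>r. sphere_integral (f r)) has_integral integral {R1..R} (\<lambda>r. sphere_integral (f r))) {R1..R}"
      using R1 by (intro integrable_integral integrable_continuous_real continuous_on_subset[OF cont]) auto
    ultimately have "((\<lambda>r. sphere_integral (f r) - A / r) has_integral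
        integral {R1..R} (\<lambda>r. sphere_integral (f r)) - (A * ln R - A * ln R1)) {R1..R}"
      by (intro has_integral_diff)
    then show ?case
      by (simp add: integral_unique)
  qed
  then have "((\<lambda>R. integral {R1..R} (\<lambda>r. sphere_integral (f r)) - A * ln R) \<longlongrightarrow> L - A * ln R1) at_top"
    using tendsto_diff[OF L tendsto_const] by (rule Lim_transform_eventually[rotated])
  then show "\<exists>L. ((\<lambda>R. integral {R1..R} (\<lambda>r. sphere_integral (f r)) - sphere_integral a * ln R) \<longlongrightarrow> L) at_top"
    unfolding A_def by blast
qed

text \<open>With a vanishing coefficient the logarithmic statement becomes plain convergence;
  continuity supplies absolute integrability over each sphere and each bounded shell.\<close>

lemma has_leading_finite:
  assumes lead: "has_leading R0 2 f a" and R0: "0 < R0" and a: "sphere_integral a = 0"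
  shows "finite_at_infinity R0 f"
proof -
  have cont: "continuous_on {R0<..} (\<lambda>r. sphere_integral (f r))"
    using lead by (intro continuous_on_sphere_integral) (auto simp: has_leading_def)
  show ?thesis
    using has_leading_log_divergence[OF lead R0] a
    by (auto simp: finite_at_infinity_def log_divergence_def
        intro!: sphere_integrable_continuous has_leading_continuous_slice[OF lead]
          absolutely_integrable_continuous_real continuous_on_subset[OF cont])
qed

section \<open>Products and linear combinations of quantities with a leading coefficient\<close>

lemma has_leading_mult:
  assumes f: "has_leading R0 n f a" and g: "has_leading R0 m g b" and nm: "n + m = 3"
  shows "has_leading R0 2 (\<lambda>r c x. f r c x * g r c x) (\<lambda>c x. a c x * b c x)"
  unfolding has_leading_def
proof (intro allI conjI)
  fix c
  have cont: "continuous_on ({R0<..} \<times> cball 0 1) (\<lambda>(r, x). f r c x)" "continuous_on (cball 0 1) (a c)"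
    "continuous_on ({R0<..} \<times> cball 0 1) (\<lambda>(r, x). g r c x)" "continuous_on (cball 0 1) (b c)"
    using f g by (auto simp: has_leading_def)
  show "continuous_on ({R0<..} \<times> cball 0 1) (\<lambda>(r, x). f r c x * g r c x)"
    using continuous_on_mult[OF cont(1,3)] by (simp add: case_prod_unfold)
  show "continuous_on (cball 0 1) (\<lambda>x. a c x * b c x)"
    using cont by (intro continuous_intros)
  obtain M where M: "\<forall>\<^sub>F r in at_top. \<forall>x\<in>cball 0 1. \<bar>r ^ n / r * f r c x - a c x\<bar> \<le> M / r"
    using f by (auto simp: has_leading_def)
  obtain N where N: "\<forall>\<^sub>F r in at_top. \<forall>x\<in>cball 0 1. \<bar>r ^ m / r * g r c x - b c x\<bar> \<le> N / r"
    using g by (auto simp: has_leading_def)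
  obtain A where A: "\<And>x. x \<in> cball 0 1 \<Longrightarrow> \<bar>a c x\<bar> \<le> A"
    using continuous_on_compact_abs_bounded[OF cont(2) compact_cball] by blast
  obtain B where B: "\<And>x. x \<in> cball 0 1 \<Longrightarrow> \<bar>b c x\<bar> \<le> B"
    using continuous_on_compact_abs_bounded[OF cont(4) compact_cball] by blast
  have "\<forall>\<^sub>F r in at_top. \<forall>x\<in>cball 0 1.
      \<bar>r ^ 2 / r * (f r c x * g r c x) - a c x * b c x\<bar> \<le> (M * (B + \<bar>N\<bar>) + A * N) / r"
    using M N eventually_ge_at_top[of 1]
  proof eventually_elim
    case (elim r)
    show ?case
    proof
      fix x :: "real^2" assume x: "x \<in> cball 0 1"
      define u v where "u = r ^ n / r * f r c x" and "v = r ^ m / r * g r c x"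
      have u: "\<bar>u - a c x\<bar> \<le> M / r" and v: "\<bar>v - b c x\<bar> \<le> N / r"
        using elim x by (auto simp: u_def v_def)
      \<comment> \<open>Both sides carry the power r: the normalisations of the factors multiply to
        r^(n + m - 2), and n + m = 3.\<close>
      have "r ^ 2 / r * (f r c x * g r c x) = r ^ (n + m) / (r * r) * (f r c x * g r c x)"
        using elim(3) by (simp add: nm power3_eq_cube power2_eq_square)
      also have "\<dots> = u * v"
        by (simp add: u_def v_def power_add)
      finally have uv: "r ^ 2 / r * (f r c x * g r c x) = u * v" .
      \<comment> \<open>For r \<ge> 1 the error of v is at most the absolute value of N, so v is
        bounded independently of r.\<close>
      have "N / r \<le> \<bar>N\<bar>"
        using elim(3) by (simp add: divide_le_eq order_trans[OF abs_ge_self[of N]] mult_le_cancel_left1)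
      then have "\<bar>v\<bar> \<le> B + \<bar>N\<bar>"
        using v B[OF x] by linarith
      then have "\<bar>u - a c x\<bar> * \<bar>v\<bar> \<le> M / r * (B + \<bar>N\<bar>)"
        using u by (intro mult_mono) auto
      moreover have "\<bar>a c x\<bar> * \<bar>v - b c x\<bar> \<le> A * (N / r)"
        using v A[OF x] by (intro mult_mono) auto
      moreover have "u * v - a c x * b c x = (u - a c x) * v + a c x * (v - b c x)"
        by (simp add: algebra_simps)
      then have "\<bar>u * v - a c x * b c x\<bar> \<le> \<bar>u - a c x\<bar> * \<bar>v\<bar> + \<bar>a c x\<bar> * \<bar>v - b c x\<bar>"
        by (metis abs_mult abs_triangle_ineq)
      ultimately show "\<bar>r ^ 2 / r * (f r c x * g r c x) - a c x * b c x\<bar> \<le> (M * (B + \<bar>N\<bar>) + A * N) / r"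
        unfolding uv add_divide_distrib by simp
    qed
  qed
  then show "\<exists>M. \<forall>\<^sub>F r in at_top. \<forall>x\<in>cball 0 1. \<bar>r ^ 2 / r * (f r c x * g r c x) - a c x * b c x\<bar> \<le> M / r" ..
qed

lemma has_leading_zero: "has_leading R0 n (\<lambda>_ _ _. 0) (\<lambda>_ _. 0)"
  by (auto simp: has_leading_def intro!: exI[of _ 0])

lemma has_leading_add:
  assumes f: "has_leading R0 n f a" and g: "has_leading R0 n g b"
  shows "has_leading R0 n (\<lambda>r c x. f r c x + g r c x) (\<lambda>c x. a c x + b c x)"
  unfolding has_leading_def
proof (intro allI conjI)
  fix c
  have cont: "continuous_on ({R0<..} \<times> cball 0 1) (\<lambda>(r, x). f r c x)" "continuous_on (cball 0 1) (a c)"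
    "continuous_on ({R0<..} \<times> cball 0 1) (\<lambda>(r, x). g r c x)" "continuous_on (cball 0 1) (b c)"
    using f g by (auto simp: has_leading_def)
  show "continuous_on ({R0<..} \<times> cball 0 1) (\<lambda>(r, x). f r c x + g r c x)"
    using continuous_on_add[OF cont(1,3)] by (simp add: case_prod_unfold)
  show "continuous_on (cball 0 1) (\<lambda>x. a c x + b c x)"
    using cont by (intro continuous_intros)
  obtain M where M: "\<forall>\<^sub>F r in at_top. \<forall>x\<in>cball 0 1. \<bar>r ^ n / r * f r c x - a c x\<bar> \<le> M / r"
    using f by (auto simp: has_leading_def)
  obtain N where N: "\<forall>\<^sub>F r in at_top. \<forall>x\<in>cball 0 1. \<bar>r ^ n / r * g r c x - b c x\<bar> \<le> N / r"
    using g by (auto simp: has_leading_def)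
  have "\<forall>\<^sub>F r in at_top. \<forall>x\<in>cball 0 1. \<bar>r ^ n / r * (f r c x + g r c x) - (a c x + b c x)\<bar> \<le> (M + N) / r"
    using M N
  proof eventually_elim
    case (elim r)
    show ?case
    proof
      fix x :: "real^2" assume "x \<in> cball 0 1"
      then have "\<bar>r ^ n / r * f r c x - a c x\<bar> \<le> M / r" "\<bar>r ^ n / r * g r c x - b c x\<bar> \<le> N / r"
        using elim by auto
      then show "\<bar>r ^ n / r * (f r c x + g r c x) - (a c x + b c x)\<bar> \<le> (M + N) / r"
        unfolding add_divide_distrib distrib_left by linarith
    qed
  qed
  then show "\<exists>M. \<forall>\<^sub>F r in at_top. \<forall>x\<in>cball 0 1. \<bar>r ^ n / r * (f r c x + g r c x) - (a c x + b c x)\<bar> \<le> M / r" ..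
qed

lemma has_leading_minus:
  assumes "has_leading R0 n f a"
  shows "has_leading R0 n (\<lambda>r c x. - f r c x) (\<lambda>c x. - a c x)"
  using assms unfolding has_leading_def mult_minus_right minus_diff_minus abs_minus_cancel case_prod_unfold
  by (simp add: continuous_on_minus)

lemma has_leading_diff:
  assumes "has_leading R0 n f a" and "has_leading R0 n g b"
  shows "has_leading R0 n (\<lambda>r c x. f r c x - g r c x) (\<lambda>c x. a c x - b c x)"
  using has_leading_add[OF assms(1) has_leading_minus[OF assms(2)]] by simp

lemma has_leading_sum:
  assumes "\<And>i. i \<in> I \<Longrightarrow> has_leading R0 n (f i) (a i)"
  shows "has_leading R0 n (\<lambda>r c x. \<Sum>i\<in>I. f i r c x) (\<lambda>c x. \<Sum>i\<in>I. a i c x)"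
  using assms
  by (induction I rule: infinite_finite_induct) (auto intro: has_leading_zero has_leading_add)


section \<open>Asymptotic expansions and their time derivatives\<close>

lemma smooth_on_differentiable: "smooth_on S f \<Longrightarrow> z \<in> S \<Longrightarrow> f differentiable (at z)"
  using iter_partial.simps(1)[of f] unfolding smooth_on_def by (metis empty_set empty_subsetI)

lemma smooth_on_partial_differentiable:
  assumes "smooth_on S f" "z \<in> S" "b \<in> Basis"
  shows "partial b f differentiable (at z)"
  using assms(1)[unfolded smooth_on_def, rule_format, of "[b]" z] assms(2,3) by simp

lemma time_axis_in_Basis: "(1, 0) \<in> (Basis :: (real \<times> 'a::euclidean_space) set)"
  by (simp add: Basis_prod_def)

text \<open>Links the two notions of time derivative in play: expansions are differentiated by
  \<open>partial\<close> in the direction (1, 0) of spacetime, while velocities are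
  \<open>deriv\<close> at a fixed point. The chain rule along s to (s, y) identifies them.\<close>

lemma has_real_derivative_time_slice:
  assumes "(\<lambda>(s, z). f s z) differentiable (at (t, y))"
  shows "((\<lambda>s. f s y) has_real_derivative partial (1, 0) (\<lambda>(s, z). f s z) (t, y)) (at t)"
proof -
  define D where "D = frechet_derivative (\<lambda>(s, z). f s z) (at (t, y))"
  have D: "((\<lambda>(s, z). f s z) has_derivative D) (at (t, y))"
    using assms by (simp add: D_def frechet_derivative_works)
  then interpret D: bounded_linear D
    by (rule has_derivative_bounded_linear)
  have "((\<lambda>s. (s, y)) has_derivative (\<lambda>h. (h, 0))) (at t)"
    by (auto intro!: derivative_eq_intros)
  then have "((\<lambda>s. f s y) has_derivative (\<lambda>h. D (h, 0))) (at t)"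
    using has_derivative_compose[of "\<lambda>s. (s, y)" "\<lambda>h. (h, 0)" t UNIV "\<lambda>(s, z). f s z" D] D by simp
  moreover have "D (h, 0) = partial (1, 0) (\<lambda>(s, z). f s z) (t, y) * h" for h
    using D.scaleR[of h "(1, 0)"] by (simp add: partial_def D_def mult.commute)
  ultimately show ?thesis
    by (simp add: has_field_derivative_def)
qed

lemma smooth_on_has_real_derivative:
  assumes "smooth_on (T \<times> S) (\<lambda>(s, z). f s z)" "t \<in> T" "y \<in> S"
  shows "((\<lambda>s. f s y) has_real_derivative deriv (\<lambda>s. f s y) t) (at t)"
  using has_real_derivative_time_slice[OF smooth_on_differentiable[OF assms(1)], of t y] assms(2,3)
  by (metis DERIV_imp_deriv mem_Sigma_iff)

lemma smooth_on_continuous_slice: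
  assumes "smooth_on (T \<times> S) (\<lambda>(s, z). f s z)" "t \<in> T"
  shows "continuous_on S (f t)"
proof -
  have "continuous_on (T \<times> S) (\<lambda>(s, z). f s z)"
    using smooth_on_differentiable[OF assms(1)]
    by (intro continuous_at_imp_continuous_on ballI differentiable_imp_continuous_within)
  then have "continuous_on S (\<lambda>y. case (t, y) of (s, z) \<Rightarrow> f s z)"
    by (rule continuous_on_compose2) (use assms in \<open>auto intro!: continuous_intros\<close>)
  then show ?thesis by simp
qed

lemma smooth_on_continuous_deriv:
  fixes f :: "real \<Rightarrow> 'a::euclidean_space \<Rightarrow> real"
  assumes f: "smooth_on (T \<times> S) (\<lambda>(s, z). f s z)" and t: "t \<in> T"
  shows "continuous_on S (\<lambda>y. deriv (\<lambda>s. f s y) t)"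
proof -
  have "continuous_on (T \<times> S) (partial (1, 0) (\<lambda>(s, z). f s z))"
    by (intro continuous_at_imp_continuous_on ballI differentiable_imp_continuous_within
        smooth_on_partial_differentiable[OF f] time_axis_in_Basis)
  then have "continuous_on S (\<lambda>y. partial (1, 0) (\<lambda>(s, z). f s z) (t, y))"
    by (rule continuous_on_compose2) (use t in \<open>auto intro!: continuous_intros\<close>)
  moreover have "deriv (\<lambda>s. f s y) t = partial (1, 0) (\<lambda>(s, z). f s z) (t, y)" if "y \<in> S" for y
    using has_real_derivative_time_slice[OF smooth_on_differentiable[OF f], of t y] that t
    by (simp add: DERIV_imp_deriv)
  ultimately show ?thesis
    by (simp cong: continuous_on_cong)
qed

section \<open>Coordinates near infinity and regularity of the round metric\<close>

lemma rad_pt [simp]: "rad (pt r x) = r" and ang_pt [simp]: "ang (pt r x) = x"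
  by (simp_all add: rad_def ang_def pt_def)

lemma bounded_linear_rad: "bounded_linear rad"
  unfolding rad_def by (rule bounded_linear_vec_nth)

lemma bounded_linear_ang: "bounded_linear ang"
  unfolding ang_def by (intro linear_conv_bounded_linear[THEN iffD1] linearI) (auto simp: vec_eq_iff)

lemma continuous_on_pt: "continuous_on S (\<lambda>(r, x). pt r x)"
proof -
  have "continuous_on S (\<lambda>z. case i of None \<Rightarrow> fst z | Some A \<Rightarrow> snd z $ A)" for i :: idx
    by (cases i) (auto intro!: continuous_intros)
  then show ?thesis
    unfolding pt_def case_prod_unfold by (intro continuous_intros)
qed

text \<open>The chart is the scalar 1 / (1 + x \<bullet> x) times a polynomial vector written in the
  constant vectors u, v, w, and the formula is the product rule. The explicit form makes the
  derivative visibly differentiable in x.\<close>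

lemma stereo_has_derivative:
  fixes c x
  defines "u \<equiv> vector [2, 0, 0] :: real^3" and "v \<equiv> vector [0, 2, 0] :: real^3"
    and "w \<equiv> vector [0, 0, pole_sign c] :: real^3"
  shows "(stereo c has_derivative (\<lambda>h.
      (- (2 * (x \<bullet> h)) / (1 + x \<bullet> x)\<^sup>2) *\<^sub>R (x $ 1 *\<^sub>R u + x $ 2 *\<^sub>R v + (1 - x \<bullet> x) *\<^sub>R w)
      + (1 / (1 + x \<bullet> x)) *\<^sub>R (h $ 1 *\<^sub>R u + h $ 2 *\<^sub>R v - (2 * (x \<bullet> h)) *\<^sub>R w))) (at x)"
proof -
  have stereo: "stereo c = (\<lambda>x. (1 / (1 + x \<bullet> x)) *\<^sub>R (x $ 1 *\<^sub>R u + x $ 2 *\<^sub>R v + (1 - x \<bullet> x) *\<^sub>R w))"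
    by (rule ext) (simp add: stereo_def u_def v_def w_def vec_eq_iff forall_3 vector_3 power2_norm_eq_inner mult.commute)
  have pos: "1 + x \<bullet> x \<noteq> 0"
    by (metis add_pos_nonneg inner_ge_zero less_irrefl zero_less_one)
  have q: "((\<lambda>x. 1 / (1 + x \<bullet> x)) has_derivative (\<lambda>h. - (2 * (x \<bullet> h)) / (1 + x \<bullet> x)\<^sup>2)) (at x)"
    using pos by (auto intro!: derivative_eq_intros simp: inner_commute power2_eq_square)
  have v: "((\<lambda>x. x $ 1 *\<^sub>R u + x $ 2 *\<^sub>R v + (1 - x \<bullet> x) *\<^sub>R w) has_derivative
      (\<lambda>h. h $ 1 *\<^sub>R u + h $ 2 *\<^sub>R v - (2 * (x \<bullet> h)) *\<^sub>R w)) (at x)"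
    by (auto intro!: derivative_eq_intros bounded_linear.has_derivative[OF bounded_linear_vec_nth]
        simp: inner_commute scaleR_left_distrib)
  show ?thesis
    unfolding stereo by (rule has_derivative_eq_rhs[OF has_derivative_scaleR[OF q v]]) (simp add: add.commute)
qed

text \<open>Serves the static term r^2 times the round metric in the expansion of the angular
  components, which must be differentiable in space before it can be removed by a time
  derivative.\<close>

lemma round_metric_differentiable: "(\<lambda>x. round_metric c x $ A $ B) differentiable (at x)"
proof -
  have pos: "1 + y \<bullet> y \<noteq> 0" for y :: "real^2"
    by (metis add_pos_nonneg inner_ge_zero less_irrefl zero_less_one)
  have "partial (axis A 1) (stereo c) differentiable (at x)" for A
    unfolding partial_def[abs_def] frechet_derivative_at[OF stereo_has_derivative, symmetric]
    by (intro derivative_intros differentiable_inner differentiable_scaleR differentiable_divide differentiable_power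
        differentiable_const differentiable_ident bounded_linear_imp_differentiable bounded_linear_vec_nth)
      (auto simp: pos)
  then show ?thesis
    by (auto simp: round_metric_def intro!: differentiable_inner)
qed

section \<open>From expansions to leading coefficients\<close>

lemma remainder_small:
  assumes "has_expansion T n f e" "t \<in> T" "set ds \<subseteq> Basis" "(0, axis None 1) \<notin> set ds"
  shows "\<forall>\<^sub>F r in at_top. \<forall>x\<in>cball 0 1.
    \<bar>r ^ n * iter_partial ds (\<lambda>(s, z). f c s z - e c s (rad z) (ang z)) (t, pt r x)\<bar> \<le> 1"
proof -
  \<comment> \<open>The radial direction does not occur in \<open>ds\<close>, so no power of 1/r is
    gained and the exponent stays n.\<close>
  have "small_o n (\<lambda>c y. iter_partial ds (\<lambda>(s, z). f c s z - e c s (rad z) (ang z)) (t, y))"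
    using assms by (force simp: has_expansion_def count_list_0_iff)
  then have "uniform_limit (cball 0 1)
      (\<lambda>r x. r ^ n * iter_partial ds (\<lambda>(s, z). f c s z - e c s (rad z) (ang z)) (t, pt r x)) (\<lambda>_. 0) at_top"
    by (simp add: small_o_def)
  \<comment> \<open>The bound 1 is one arbitrary choice: the remainder is one order below the
    leading power, so boundedness after multiplication by r^n is enough.\<close>
  from uniform_limitD[OF this zero_less_one] show ?thesis
    by eventually_elim (auto simp: dist_real_def intro: less_imp_le)
qed

text \<open>The leading power r^(1-n) is written \<open>r / r ^ n\<close>, which also covers n = 0.
  After normalisation the subleading coefficient b and the rescaled remainder, bounded by 1, are
  both divided by r; hence B + 1.\<close>

lemma leading_bound:
  assumes "r \<ge> 1" "\<bar>b\<bar> \<le> B" "\<bar>r ^ n * (f - r / r ^ n * (a + b / r))\<bar> \<le> (1 :: real)"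
  shows "\<bar>r ^ n / r * f - a\<bar> \<le> (B + 1) / r"
proof -
  have "r ^ n / r * f - a = (r ^ n * (f - r / r ^ n * (a + b / r)) + b) / r"
    using assms(1) by (simp add: field_simps)
  then show ?thesis
    using assms by (simp add: abs_divide divide_right_mono)
qed

lemma expansion_has_leading:
  assumes exp: "has_expansion T n f e" and t: "t \<in> T"
    and f: "\<And>c. smooth_on (T \<times> {y. R0 < rad y}) (\<lambda>(s, y). f c s y)"
    and a: "\<And>c. smooth_on (T \<times> UNIV) (\<lambda>(s, x). a c s x)"
    and b: "\<And>c. smooth_on (T \<times> UNIV) (\<lambda>(s, x). b c s x)"
    and e: "\<And>c s r x. 0 < r \<Longrightarrow> e c s r x = r / r ^ n * (a c s x + b c s x / r)"
  shows "has_leading R0 n (\<lambda>r c x. f c t (pt r x)) (\<lambda>c x. a c t x)"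
  unfolding has_leading_def
proof (intro allI conjI)
  fix c
  have "continuous_on ({R0<..} \<times> cball 0 1) (\<lambda>z. f c t (case z of (r, x) \<Rightarrow> pt r x))"
    by (rule continuous_on_compose2[OF smooth_on_continuous_slice[OF f t] continuous_on_pt]) auto
  then show "continuous_on ({R0<..} \<times> cball 0 1) (\<lambda>(r, x). f c t (pt r x))"
    by (simp add: case_prod_unfold)
  show "continuous_on (cball 0 1) (a c t)"
    using smooth_on_continuous_slice[OF a t] by (rule continuous_on_subset) auto
  have "continuous_on (cball 0 1) (b c t)"
    using smooth_on_continuous_slice[OF b t] by (rule continuous_on_subset) auto
  from continuous_on_compact_abs_bounded[OF this compact_cball]
  obtain B where B: "\<And>x. x \<in> cball 0 1 \<Longrightarrow> \<bar>b c t x\<bar> \<le> B"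
    by blast
  have "\<forall>\<^sub>F r in at_top. \<forall>x\<in>cball 0 1. \<bar>r ^ n * (f c t (pt r x) - e c t r x)\<bar> \<le> 1"
    using remainder_small[OF exp t, of "[]" c] by simp
  then have "\<forall>\<^sub>F r in at_top. \<forall>x\<in>cball 0 1. \<bar>r ^ n / r * f c t (pt r x) - a c t x\<bar> \<le> (B + 1) / r"
    using eventually_ge_at_top[of 1]
  proof eventually_elim
    case (elim r)
    show ?case
    proof
      fix x :: "real^2" assume x: "x \<in> cball 0 1"
      have "e c t r x = r / r ^ n * (a c t x + b c t x / r)"
        using elim(2) by (intro e) simp
      then show "\<bar>r ^ n / r * f c t (pt r x) - a c t x\<bar> \<le> (B + 1) / r"
        using leading_bound[OF elim(2) B[OF x]] elim(1) x by metis
    qed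
  qed
  then show "\<exists>M. \<forall>\<^sub>F r in at_top. \<forall>x\<in>cball 0 1. \<bar>r ^ n / r * f c t (pt r x) - a c t x\<bar> \<le> M / r" ..
qed

text \<open>The term g collects what does not depend on time and may outgrow the leading power; it
  has zero velocity. What remains has the shape treated by \<open>leading_bound\<close>, with time
  derivatives in place of the coefficients.\<close>

lemma expansion_deriv_has_leading:
  assumes exp: "has_expansion T n f e" and t: "t \<in> T"
    and f: "\<And>c. smooth_on (T \<times> {y. R0 < rad y}) (\<lambda>(s, y). f c s y)"
    and a: "\<And>c. smooth_on (T \<times> UNIV) (\<lambda>(s, x). a c s x)"
    and b: "\<And>c. smooth_on (T \<times> UNIV) (\<lambda>(s, x). b c s x)"
    and e: "\<And>c s r x. 0 < r \<Longrightarrow> e c s r x = g c r x + r / r ^ n * (a c s x + b c s x / r)"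
    and g: "\<And>c y. (\<lambda>y. g c (rad y) (ang y)) differentiable (at y)"
  shows "has_leading R0 n (\<lambda>r c x. deriv (\<lambda>s. f c s (pt r x)) t) (\<lambda>c x. deriv (\<lambda>s. a c s x) t)"
  unfolding has_leading_def
proof (intro allI conjI)
  fix c
  have "continuous_on ({R0<..} \<times> cball 0 1) (\<lambda>z. deriv (\<lambda>s. f c s (case z of (r, x) \<Rightarrow> pt r x)) t)"
    by (rule continuous_on_compose2[OF smooth_on_continuous_deriv[OF f t] continuous_on_pt]) auto
  then show "continuous_on ({R0<..} \<times> cball 0 1) (\<lambda>(r, x). deriv (\<lambda>s. f c s (pt r x)) t)"
    by (simp add: case_prod_unfold)
  show "continuous_on (cball 0 1) (\<lambda>x. deriv (\<lambda>s. a c s x) t)"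
    using smooth_on_continuous_deriv[OF a t] by (rule continuous_on_subset) auto
  have "continuous_on (cball 0 1) (\<lambda>x. deriv (\<lambda>s. b c s x) t)"
    using smooth_on_continuous_deriv[OF b t] by (rule continuous_on_subset) auto
  from continuous_on_compact_abs_bounded[OF this compact_cball]
  obtain B where B: "\<And>x. x \<in> cball 0 1 \<Longrightarrow> \<bar>deriv (\<lambda>s. b c s x) t\<bar> \<le> B"
    by blast
  \<comment> \<open>The hypothesis controls the left side. It splits only because f and e are both
    differentiable in (t, y) jointly, which the following facts establish for e.\<close>
  have rem: "partial (1, 0) (\<lambda>(s, z). f c s z - e c s (rad z) (ang z)) (t, pt r x) =
      deriv (\<lambda>s. f c s (pt r x)) t
      - r / r ^ n * (deriv (\<lambda>s. a c s x) t + deriv (\<lambda>s. b c s x) t / r)" if r: "0 < r" "R0 < r" for r x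
  proof -
    have ang: "(\<lambda>p. (fst p, ang (snd p))) differentiable F" for F :: "(real \<times> (real^idx)) filter"
      by (intro bounded_linear_imp_differentiable bounded_linear_Pair bounded_linear_fst
          bounded_linear_compose[OF bounded_linear_ang bounded_linear_snd])
    have rad: "(\<lambda>p. rad (snd p)) differentiable F" for F :: "(real \<times> (real^idx)) filter"
      by (intro bounded_linear_imp_differentiable bounded_linear_compose[OF bounded_linear_rad bounded_linear_snd])
    have coeff: "(\<lambda>p. h c (fst p) (ang (snd p))) differentiable (at (t, pt r x))"
      if "\<And>c. smooth_on (T \<times> UNIV) (\<lambda>(s, x). h c s x)" for h :: "chart \<Rightarrow> real \<Rightarrow> real^2 \<Rightarrow> real"
      using differentiable_chain_at[OF ang, of "\<lambda>(s, x). h c s x" "(t, pt r x)"]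
        smooth_on_differentiable[OF that, of "(t, x)" c] t by (simp add: o_def)
    have "(\<lambda>p. g c (rad (snd p)) (ang (snd p))) differentiable (at (t, pt r x))"
      using differentiable_chain_at[OF bounded_linear_imp_differentiable[OF bounded_linear_snd] g[of c], of "(t, pt r x)"]
      by (simp add: o_def)
    then have "(\<lambda>p. g c (rad (snd p)) (ang (snd p)) + rad (snd p) / rad (snd p) ^ n *
        (a c (fst p) (ang (snd p)) + b c (fst p) (ang (snd p)) / rad (snd p))) differentiable (at (t, pt r x))"
      using r by (intro differentiable_add differentiable_mult differentiable_divide differentiable_power rad
        coeff[OF a] coeff[OF b]) auto
    \<comment> \<open>The closed form of e is given only for positive radius; this open set is where
      the derivative is transferred from the formula to e.\<close>
    moreover have "open {p :: real \<times> (real^idx). 0 < rad (snd p)}"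
      by (intro open_Collect_less continuous_intros linear_continuous_on
          bounded_linear_compose[OF bounded_linear_rad bounded_linear_snd])
    ultimately have "(\<lambda>(s, z). e c s (rad z) (ang z)) differentiable (at (t, pt r x))"
      using r e unfolding differentiable_def
      by (elim exE, intro exI) (erule has_derivative_transform_within_open, auto)
    then have "(\<lambda>(s, z). f c s z - e c s (rad z) (ang z)) differentiable (at (t, pt r x))"
      using differentiable_diff[OF smooth_on_differentiable[OF f, of "(t, pt r x)" c]] t r
      by (simp add: case_prod_unfold)
    from has_real_derivative_time_slice[OF this]
    have "((\<lambda>s. f c s (pt r x) - (g c r x + r / r ^ n * (a c s x + b c s x / r)))
        has_real_derivative partial (1, 0) (\<lambda>(s, z). f c s z - e c s (rad z) (ang z)) (t, pt r x)) (at t)"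
      using r by (simp add: e)
    \<comment> \<open>The same slice differentiated term by term, g contributing 0; uniqueness of
      the derivative then gives the identity.\<close>
    moreover have "((\<lambda>s. f c s (pt r x) - (g c r x + r / r ^ n * (a c s x + b c s x / r)))
        has_real_derivative deriv (\<lambda>s. f c s (pt r x)) t
          - (0 + r / r ^ n * (deriv (\<lambda>s. a c s x) t + deriv (\<lambda>s. b c s x) t / r))) (at t)"
      using r t by (intro DERIV_diff DERIV_add DERIV_const DERIV_cmult DERIV_cdivide
        smooth_on_has_real_derivative[OF f] smooth_on_has_real_derivative[OF a] smooth_on_has_real_derivative[OF b]) auto
    ultimately show ?thesis
      using DERIV_unique by fastforce
  qed
  have "\<forall>\<^sub>F r in at_top. \<forall>x\<in>cball 0 1.
      \<bar>r ^ n * partial (1, 0) (\<lambda>(s, z). f c s z - e c s (rad z) (ang z)) (t, pt r x)\<bar> \<le> 1"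
    using remainder_small[OF exp t, of "[(1, 0)]" c] time_axis_in_Basis by simp
  then have "\<forall>\<^sub>F r in at_top. \<forall>x\<in>cball 0 1.
      \<bar>r ^ n / r * deriv (\<lambda>s. f c s (pt r x)) t - deriv (\<lambda>s. a c s x) t\<bar> \<le> (B + 1) / r"
    using eventually_ge_at_top[of 1] eventually_gt_at_top[of R0]
  proof eventually_elim
    case (elim r)
    show ?case
    proof
      fix x :: "real^2" assume x: "x \<in> cball 0 1"
      show "\<bar>r ^ n / r * deriv (\<lambda>s. f c s (pt r x)) t - deriv (\<lambda>s. a c s x) t\<bar> \<le> (B + 1) / r"
        using leading_bound[OF elim(2) B[OF x]] elim(1)[rule_format, OF x] rem[of r x] elim(2,3) by simp
    qed
  qed
  then show "\<exists>M. \<forall>\<^sub>F r in at_top. \<forall>x\<in>cball 0 1.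
      \<bar>r ^ n / r * deriv (\<lambda>s. f c s (pt r x)) t - deriv (\<lambda>s. a c s x) t\<bar> \<le> M / r" ..
qed


section \<open>Leading coefficients of the fields\<close>

text \<open>
  The order \<open>n\<close> of a component is the one in its remainder \<open>o(r\<^sup>-\<^sup>n)\<close>; the leading
  time-dependent term then carries the power \<open>r\<^sup>1\<^sup>-\<^sup>n\<close>.
\<close>

fun metric_order :: "idx \<Rightarrow> idx \<Rightarrow> nat" where
  "metric_order None None = 2"
| "metric_order None (Some A) = 1"
| "metric_order (Some A) None = 1"
| "metric_order (Some A) (Some B) = 0"

fun momentum_order :: "idx \<Rightarrow> idx \<Rightarrow> nat" where
  "momentum_order None None = 1"
| "momentum_order None (Some A) = 2"
| "momentum_order (Some A) None = 2"
| "momentum_order (Some A) (Some B) = 3"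

text \<open>The mixed components get 0: their remainder is o(1/r), so the leading slot is r^0, while
  their expansion starts at 1/r. The coefficient \<open>hrA_2\<close> is therefore already
  subleading.\<close>

fun metric_lead :: "coeffs \<Rightarrow> idx \<Rightarrow> idx \<Rightarrow> chart \<Rightarrow> real \<Rightarrow> real^2 \<Rightarrow> real" where
  "metric_lead C None None c t x = hrr_b C c t x"
| "metric_lead C None (Some A) c t x = 0"
| "metric_lead C (Some A) None c t x = 0"
| "metric_lead C (Some A) (Some B) c t x = hAB_b C c t x $ A $ B"

fun momentum_lead :: "coeffs \<Rightarrow> idx \<Rightarrow> idx \<Rightarrow> chart \<Rightarrow> real \<Rightarrow> real^2 \<Rightarrow> real" where
  "momentum_lead C None None c t x = \<pi>rr_b C c t x"
| "momentum_lead C None (Some A) c t x = \<pi>rA_b C c t x $ A"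
| "momentum_lead C (Some A) None c t x = \<pi>rA_b C c t x $ A"
| "momentum_lead C (Some A) (Some B) c t x = \<pi>AB_b C c t x $ A $ B"

lemma metric_momentum_order: "momentum_order i j + metric_order i j = 3"
  by (cases i; cases j) auto

lemma iter_partial_const_zero: "iter_partial bs (\<lambda>_. 0) = (\<lambda>_. 0)"
  by (induction bs) (auto simp: partial_def frechet_derivative_const)

lemma smooth_on_zero: "smooth_on S (\<lambda>_. 0)"
  by (simp add: smooth_on_def iter_partial_const_zero)

lemma sum_option_UNIV:
  "(\<Sum>i\<in>(UNIV :: 'a::finite option set). f i) = f None + (\<Sum>a\<in>UNIV. f (Some a))"
  by (simp add: UNIV_option_conv sum.reindex)

text \<open>Openness of T lets identities valid at all times of T, such as symmetry and parity, be
  differentiated in time at each of its points.\<close>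

locale boundary_conditions =
  fixes R0 :: real and T :: "real set" and F :: fields and C :: coeffs
  assumes open_T: "open T" and bc: "new_boundary_conditions R0 T F C"
begin

lemma smooth_metric: "smooth_on (T \<times> {y. R0 < rad y}) (\<lambda>(s, y). metric F c s y $ i $ j)"
  and smooth_momentum: "smooth_on (T \<times> {y. R0 < rad y}) (\<lambda>(s, y). momentum F c s y $ i $ j)"
  using bc by (auto simp: new_boundary_conditions_def is_field_history_def)

lemma metric_commute: "s \<in> T \<Longrightarrow> R0 < rad y \<Longrightarrow> metric F c s y $ i $ j = metric F c s y $ j $ i"
  and momentum_commute: "s \<in> T \<Longrightarrow> R0 < rad y \<Longrightarrow> momentum F c s y $ i $ j = momentum F c s y $ j $ i"
  using bc by (auto simp: new_boundary_conditions_def is_field_history_def transpose_def vec_eq_iff)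

lemma coeffs_smooth: "coeffs_smooth T C"
  using bc by (simp add: new_boundary_conditions_def)

lemma smooth_metric_lead: "smooth_on (T \<times> UNIV) (\<lambda>(s, x). metric_lead C i j c s x)"
  using coeffs_smooth smooth_on_zero[of "T \<times> UNIV"]
  by (cases i; cases j) (auto simp: coeffs_smooth_def case_prod_unfold)

lemma smooth_momentum_lead: "smooth_on (T \<times> UNIV) (\<lambda>(s, x). momentum_lead C i j c s x)"
  using coeffs_smooth by (cases i; cases j) (auto simp: coeffs_smooth_def)

lemma deriv_commute:
  assumes "t \<in> T" "R0 < rad y"
  shows "deriv (\<lambda>s. metric F c s y $ i $ j) t = deriv (\<lambda>s. metric F c s y $ j $ i) t"
    and "deriv (\<lambda>s. momentum F c s y $ i $ j) t = deriv (\<lambda>s. momentum F c s y $ j $ i) t"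
proof -
  have T: "\<forall>\<^sub>F s in nhds t. s \<in> T"
    using assms open_T by (simp add: eventually_nhds_in_open)
  show "deriv (\<lambda>s. metric F c s y $ i $ j) t = deriv (\<lambda>s. metric F c s y $ j $ i) t"
    using T by (intro deriv_cong_ev) (auto elim!: eventually_mono simp: metric_commute[OF _ assms(2)])
  show "deriv (\<lambda>s. momentum F c s y $ i $ j) t = deriv (\<lambda>s. momentum F c s y $ j $ i) t"
    using T by (intro deriv_cong_ev) (auto elim!: eventually_mono simp: momentum_commute[OF _ assms(2)])
qed

lemma metric_deriv_has_leading:
  assumes t: "t \<in> T"
  shows "has_leading R0 (metric_order i j) (\<lambda>r c x. deriv (\<lambda>s. metric F c s (pt r x) $ i $ j) t)
    (\<lambda>c x. deriv (\<lambda>s. metric_lead C i j c s x) t)"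
proof -
  have fall: "field_falloff T F C"
    using bc by (simp add: new_boundary_conditions_def)
  note smooth = coeffs_smooth[unfolded coeffs_smooth_def] smooth_on_zero[of "T \<times> UNIV"]
  \<comment> \<open>The whole expansion of a mixed component sits in the subleading coefficient b; a
    and g are 0.\<close>
  have rA: "has_leading R0 1 (\<lambda>r c x. deriv (\<lambda>s. metric F c s (pt r x) $ None $ Some A) t)
    (\<lambda>c x. deriv (\<lambda>s. 0) t)" for A
    by (rule expansion_deriv_has_leading[where e = "\<lambda>c t r x. hrA_2 C c t x $ A / r" and b = "\<lambda>c t x. hrA_2 C c t x $ A"
          and g = "\<lambda>c r x. 0", OF _ t smooth_metric])
      (use fall smooth in \<open>auto simp: field_falloff_def case_prod_unfold\<close>)
  show ?thesis
  proof (cases i; cases j)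
    assume ij: "i = None" "j = None"
    have "has_leading R0 2 (\<lambda>r c x. deriv (\<lambda>s. metric F c s (pt r x) $ None $ None) t)
        (\<lambda>c x. deriv (\<lambda>s. hrr_b C c s x) t)"
      by (rule expansion_deriv_has_leading[where e = "\<lambda>c t r x. 1 + hrr_b C c t x / r + hrr_2 C c t x / r^2"
            and b = "hrr_2 C" and g = "\<lambda>c r x. 1", OF _ t smooth_metric])
        (use fall smooth in \<open>auto simp: field_falloff_def power2_eq_square add_divide_distrib\<close>)
    then show ?thesis by (simp add: ij)
  next
    fix A assume ij: "i = None" "j = Some A"
    then show ?thesis using rA by simp
  next
    fix A assume ij: "i = Some A" "j = None"
    show ?thesis
      \<comment> \<open>The fall-off lists mixed components with the radial index in front; the
        transposed ones come from symmetry.\<close>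
      using has_leading_cong[OF rA deriv_commute(1)[OF t]] by (simp add: ij)
  next
    fix A B assume ij: "i = Some A" "j = Some B"
    have "(\<lambda>y. round_metric c (ang y) $ A $ B) differentiable (at y)" for c y
      using differentiable_chain_at[OF bounded_linear_imp_differentiable[OF bounded_linear_ang] round_metric_differentiable]
      by (simp add: o_def)
    then have g: "(\<lambda>y. rad y ^ 2 * round_metric c (ang y) $ A $ B) differentiable (at y)" for c y
      by (intro differentiable_mult differentiable_power bounded_linear_imp_differentiable[OF bounded_linear_rad])
    have "has_leading R0 0 (\<lambda>r c x. deriv (\<lambda>s. metric F c s (pt r x) $ Some A $ Some B) t)
        (\<lambda>c x. deriv (\<lambda>s. hAB_b C c s x $ A $ B) t)"
      by (rule expansion_deriv_has_leading[where
            e = "\<lambda>c t r x. r^2 * round_metric c x $ A $ B + r * hAB_b C c t x $ A $ B + hAB_2 C c t x $ A $ B"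
            and b = "\<lambda>c t x. hAB_2 C c t x $ A $ B" and g = "\<lambda>c r x. r^2 * round_metric c x $ A $ B", OF _ t smooth_metric])
        (use fall smooth in \<open>auto simp: field_falloff_def distrib_left intro: g\<close>)
    then show ?thesis by (simp add: ij)
  qed
qed

text \<open>Puts the three momentum expansions into the common form with leading coefficient and
  subleading b. The assumption leaves out a sphere index followed by the radial one, an order for
  which the fall-off lists no expansion.\<close>

lemma momentum_expansion:
  assumes ij: "i = None \<or> j \<noteq> None"
  obtains e b where "has_expansion T (momentum_order i j) (\<lambda>c t y. momentum F c t y $ i $ j) e"
    and "\<And>c. smooth_on (T \<times> UNIV) (\<lambda>(s, x). b c s x)"
    and "\<And>c s r x. 0 < r \<Longrightarrow> e c s r x = r / r ^ momentum_order i j * (momentum_lead C i j c s x + b c s x / r)"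
proof -
  have fall: "field_falloff T F C"
    using bc by (simp add: new_boundary_conditions_def)
  note smooth = coeffs_smooth[unfolded coeffs_smooth_def]
  show thesis
  proof (cases i; cases j)
    assume "i = None" "j = None"
    then show thesis
      using fall smooth
      by (intro that[of "\<lambda>c t r x. \<pi>rr_b C c t x + \<pi>rr_2 C c t x / r" "\<pi>rr_2 C"]) (auto simp: field_falloff_def)
  next
    fix A assume "i = None" "j = Some A"
    then show thesis
      using fall smooth
      by (intro that[of "\<lambda>c t r x. \<pi>rA_b C c t x $ A / r + \<pi>rA_2 C c t x $ A / r^2" "\<lambda>c t x. \<pi>rA_2 C c t x $ A"])
        (auto simp: field_falloff_def power2_eq_square add_divide_distrib)
  next
    fix A B assume "i = Some A" "j = Some B"
    then show thesis
      using fall smooth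
      by (intro that[of "\<lambda>c t r x. \<pi>AB_b C c t x $ A $ B / r^2 + \<pi>AB_2 C c t x $ A $ B / r^3" "\<lambda>c t x. \<pi>AB_2 C c t x $ A $ B"])
        (auto simp: field_falloff_def power2_eq_square power3_eq_cube add_divide_distrib)
  qed (use ij in auto)
qed

lemma momentum_lead_commute: "momentum_lead C i j = momentum_lead C j i" if "i = None \<or> j = None"
  using that by (cases i; cases j) (auto simp: fun_eq_iff)

lemma momentum_order_commute: "momentum_order i j = momentum_order j i"
  by (cases i; cases j) auto

lemma momentum_has_leading:
  assumes t: "t \<in> T"
  shows "has_leading R0 (momentum_order i j) (\<lambda>r c x. momentum F c t (pt r x) $ i $ j) (\<lambda>c x. momentum_lead C i j c t x)"
    and "has_leading R0 (momentum_order i j) (\<lambda>r c x. deriv (\<lambda>s. momentum F c s (pt r x) $ i $ j) t)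
      (\<lambda>c x. deriv (\<lambda>s. momentum_lead C i j c s x) t)"
proof -
  have upper: "has_leading R0 (momentum_order i j) (\<lambda>r c x. momentum F c t (pt r x) $ i $ j) (\<lambda>c x. momentum_lead C i j c t x)"
    "has_leading R0 (momentum_order i j) (\<lambda>r c x. deriv (\<lambda>s. momentum F c s (pt r x) $ i $ j) t)
      (\<lambda>c x. deriv (\<lambda>s. momentum_lead C i j c s x) t)" if ij: "i = None \<or> j \<noteq> None" for i j
  proof -
    obtain e b where exp: "has_expansion T (momentum_order i j) (\<lambda>c t y. momentum F c t y $ i $ j) e"
      and b: "\<And>c. smooth_on (T \<times> UNIV) (\<lambda>(s, x). b c s x)"
      and e: "\<And>c s r x. 0 < r \<Longrightarrow> e c s r x = r / r ^ momentum_order i j * (momentum_lead C i j c s x + b c s x / r)"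
      using momentum_expansion[OF ij] by metis
    show "has_leading R0 (momentum_order i j) (\<lambda>r c x. momentum F c t (pt r x) $ i $ j) (\<lambda>c x. momentum_lead C i j c t x)"
      by (rule expansion_has_leading[OF exp t smooth_momentum smooth_momentum_lead b e])
    show "has_leading R0 (momentum_order i j) (\<lambda>r c x. deriv (\<lambda>s. momentum F c s (pt r x) $ i $ j) t)
      (\<lambda>c x. deriv (\<lambda>s. momentum_lead C i j c s x) t)"
      by (rule expansion_deriv_has_leading[where g = "\<lambda>c r x. 0", OF exp t smooth_momentum smooth_momentum_lead b])
         (simp_all add: e)
  qed
  show "has_leading R0 (momentum_order i j) (\<lambda>r c x. momentum F c t (pt r x) $ i $ j) (\<lambda>c x. momentum_lead C i j c t x)"
  proof (cases "i = None \<or> j \<noteq> None")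
    case False
    \<comment> \<open>Here i is a sphere index and j the radial one, so the transposed component is
      covered by \<open>upper\<close> and symmetry carries the estimate over.\<close>
    then have eq: "momentum_lead C i j = momentum_lead C j i" and ji: "j = None \<or> i \<noteq> None"
      by (auto intro: momentum_lead_commute)
    have "has_leading R0 (momentum_order j i) (\<lambda>r c x. momentum F c t (pt r x) $ i $ j) (\<lambda>c x. momentum_lead C j i c t x)"
      by (rule has_leading_cong[OF upper(1)[OF ji]]) (simp add: momentum_commute[OF t, where i = i and j = j])
    with eq show ?thesis
      by (simp only: momentum_order_commute[of i j])
  qed (rule upper(1))
  show "has_leading R0 (momentum_order i j) (\<lambda>r c x. deriv (\<lambda>s. momentum F c s (pt r x) $ i $ j) t)
      (\<lambda>c x. deriv (\<lambda>s. momentum_lead C i j c s x) t)"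
  proof (cases "i = None \<or> j \<noteq> None")
    case False
    then have eq: "momentum_lead C i j = momentum_lead C j i" and ji: "j = None \<or> i \<noteq> None"
      by (auto intro: momentum_lead_commute)
    have "has_leading R0 (momentum_order j i) (\<lambda>r c x. deriv (\<lambda>s. momentum F c s (pt r x) $ i $ j) t) (\<lambda>c x. deriv (\<lambda>s. momentum_lead C j i c s x) t)"
      by (rule has_leading_cong[OF upper(2)[OF ji]]) (simp add: deriv_commute(2)[OF t, where i = i and j = j])
    with eq show ?thesis
      by (simp only: momentum_order_commute[of i j])
  qed (rule upper(2))
qed

end


section \<open>Parity\<close>

text \<open>Formulated for arbitrary components q so that it applies to the leading momentum
  coefficients and to their velocities alike. The odd combination is half of
  \<open>p_b\<close>.\<close>

definition momentum_parity :: "(idx \<Rightarrow> idx \<Rightarrow> chart \<Rightarrow> real^2 \<Rightarrow> real) \<Rightarrow> bool" where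
  "momentum_parity q \<longleftrightarrow>
     (\<forall>A B. even_components (q (Some A) (Some B))) \<and>
     odd_components (\<lambda>c x. q None None c x
       - (\<Sum>A\<in>UNIV. \<Sum>B\<in>UNIV. round_metric c x $ A $ B * q (Some A) (Some B) c x))"

text \<open>The odd combination is twice \<open>k_b\<close>, because \<open>lambda_b\<close> is half
  of \<open>hrr_b\<close>. Vanishing mixed components keep the radial-angular products out of the
  pairing.\<close>

definition metric_parity :: "(idx \<Rightarrow> idx \<Rightarrow> chart \<Rightarrow> real^2 \<Rightarrow> real) \<Rightarrow> bool" where
  "metric_parity h \<longleftrightarrow>
     even_components (h None None) \<and>
     (\<forall>A c x. h None (Some A) c x = 0 \<and> h (Some A) None c x = 0) \<and>
     (\<forall>A B. odd_components (\<lambda>c x. h (Some A) (Some B) c x + round_metric c x $ A $ B * h None None c x))"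

text \<open>
  Adding \<open>\<plusminus> (q\<^sup>A\<^sub>A) h\<^sub>r\<^sub>r\<close> turns \<open>q\<^sup>i\<^sup>j h\<^sub>i\<^sub>j\<close> into a sum of products of an even and an odd factor,
  which are \<open>p\<close>, \<open>\<lambda>\<close>, \<open>\<pi>\<^sup>A\<^sup>B\<close>, \<open>k\<^sub>A\<^sub>B\<close> up to factors of 2.
\<close>

lemma sum_idx_pairing:
  assumes "metric_parity h"
  shows "(\<Sum>i\<in>UNIV. \<Sum>j\<in>UNIV. q i j c x * h i j c x) =
    (q None None c x - (\<Sum>A\<in>UNIV. \<Sum>B\<in>UNIV. round_metric c x $ A $ B * q (Some A) (Some B) c x)) * h None None c x
    + (\<Sum>A\<in>UNIV. \<Sum>B\<in>UNIV. q (Some A) (Some B) c x * (h (Some A) (Some B) c x + round_metric c x $ A $ B * h None None c x))"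
  using assms by (simp add: metric_parity_def sum_option_UNIV UNIV_2 algebra_simps)

lemma odd_components_add:
  fixes f g :: "chart \<Rightarrow> real^2 \<Rightarrow> 'a::ab_group_add"
  shows "odd_components f \<Longrightarrow> odd_components g \<Longrightarrow> odd_components (\<lambda>c x. f c x + g c x)"
  by (simp add: odd_components_def)

lemma odd_components_sum:
  fixes f :: "'i \<Rightarrow> chart \<Rightarrow> real^2 \<Rightarrow> 'a::ab_group_add"
  shows "(\<And>i. i \<in> I \<Longrightarrow> odd_components (f i)) \<Longrightarrow> odd_components (\<lambda>c x. \<Sum>i\<in>I. f i c x)"
  by (simp add: odd_components_def sum_negf)

lemma odd_components_mult_even:
  fixes f g :: "chart \<Rightarrow> real^2 \<Rightarrow> 'a::ring"
  shows "odd_components f \<Longrightarrow> even_components g \<Longrightarrow> odd_components (\<lambda>c x. f c x * g c x)"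
  by (simp add: odd_components_def even_components_def)

lemma even_components_mult_odd:
  fixes f g :: "chart \<Rightarrow> real^2 \<Rightarrow> 'a::ring"
  shows "even_components f \<Longrightarrow> odd_components g \<Longrightarrow> odd_components (\<lambda>c x. f c x * g c x)"
  by (simp add: odd_components_def even_components_def)

lemma odd_components_pairing:
  assumes q: "momentum_parity q" and h: "metric_parity h"
  shows "odd_components (\<lambda>c x. \<Sum>i\<in>UNIV. \<Sum>j\<in>UNIV. q i j c x * h i j c x)"
  unfolding sum_idx_pairing[OF h]
proof (rule odd_components_add)
  show "odd_components (\<lambda>c x. (q None None c x
      - (\<Sum>A\<in>UNIV. \<Sum>B\<in>UNIV. round_metric c x $ A $ B * q (Some A) (Some B) c x)) * h None None c x)"
    using q h by (intro odd_components_mult_even) (auto simp: momentum_parity_def metric_parity_def)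
  show "odd_components (\<lambda>c x. \<Sum>A\<in>UNIV. \<Sum>B\<in>UNIV. q (Some A) (Some B) c x *
      (h (Some A) (Some B) c x + round_metric c x $ A $ B * h None None c x))"
    using q h by (intro odd_components_sum even_components_mult_odd) (auto simp: momentum_parity_def metric_parity_def)
qed

text \<open>The two functions of time coincide near t, so their \<open>deriv\<close> values agree by
  congruence alone.\<close>

lemma even_components_deriv:
  assumes "open T" "t \<in> T" "\<And>s. s \<in> T \<Longrightarrow> even_components (\<lambda>c x. f c s x :: real)"
  shows "even_components (\<lambda>c x. deriv (\<lambda>s. f c s x) t)"
  unfolding even_components_def
proof (intro allI deriv_cong_ev)
  fix c x
  show "\<forall>\<^sub>F s in nhds t. f (opposite c) s (- x) = f c s x"
    using eventually_nhds_in_open[OF assms(1,2)] by eventually_elim (use assms(3) in \<open>auto simp: even_components_def\<close>)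
qed auto

text \<open>Unlike in the even case a sign must be pulled out of the derivative, which uses its
  existence. A given f' appears instead of \<open>deriv\<close> because the odd quantities are
  combinations of coefficients, differentiated term by term.\<close>

lemma odd_components_deriv:
  assumes T: "open T" "t \<in> T" and odd: "\<And>s. s \<in> T \<Longrightarrow> odd_components (\<lambda>c x. f c s x :: real)"
    and f: "\<And>c x. ((\<lambda>s. f c s x) has_real_derivative f' c x) (at t)"
  shows "odd_components f'"
  unfolding odd_components_def
proof (intro allI)
  fix c x
  have "\<forall>\<^sub>F s in nhds t. f (opposite c) s (- x) = - f c s x"
    using eventually_nhds_in_open[OF T] by eventually_elim (use odd in \<open>auto simp: odd_components_def\<close>)
  then have "((\<lambda>s. f (opposite c) s (- x)) has_real_derivative v) (at t) \<longleftrightarrow>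
      ((\<lambda>s. - f c s x) has_real_derivative v) (at t)" for v
    by (rule DERIV_cong_ev[OF refl _ refl])
  then have "((\<lambda>s. - f c s x) has_real_derivative f' (opposite c) (- x)) (at t)"
    using f[of "opposite c" "- x"] by simp
  then show "f' (opposite c) (- x) = - f' c x"
    using DERIV_minus[OF f[of c x]] DERIV_unique by blast
qed

context boundary_conditions
begin

lemma has_real_derivative_lead:
  assumes "t \<in> T"
  shows "((\<lambda>s. metric_lead C i j c s x) has_real_derivative deriv (\<lambda>s. metric_lead C i j c s x) t) (at t)"
    and "((\<lambda>s. momentum_lead C i j c s x) has_real_derivative deriv (\<lambda>s. momentum_lead C i j c s x) t) (at t)"
  using smooth_on_has_real_derivative[OF smooth_metric_lead assms] smooth_on_has_real_derivative[OF smooth_momentum_lead assms]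
  by auto

lemma metric_lead_parity: "s \<in> T \<Longrightarrow> metric_parity (\<lambda>i j c x. metric_lead C i j c s x)"
  and momentum_lead_parity: "s \<in> T \<Longrightarrow> momentum_parity (\<lambda>i j c x. momentum_lead C i j c s x)"
proof -
  assume s: "s \<in> T"
  have parity: "parity_conditions T C"
    using bc by (simp add: new_boundary_conditions_def)
  have k: "2 * k_b C c s x $ A $ B = hAB_b C c s x $ A $ B + round_metric c x $ A $ B * hrr_b C c s x" for c x A B
    by (simp add: k_b_def lambda_b_def)
  have "odd_components (\<lambda>c x. 2 * k_b C c s x $ A $ B)" for A B
    using parity s by (auto simp: parity_conditions_def odd_components_def)
  then show "metric_parity (\<lambda>i j c x. metric_lead C i j c s x)"
    using parity s by (auto simp: parity_conditions_def metric_parity_def even_components_def lambda_b_def k)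
  have p: "p_b C c s x / 2 = \<pi>rr_b C c s x
      - (\<Sum>A\<in>UNIV. \<Sum>B\<in>UNIV. round_metric c x $ A $ B * \<pi>AB_b C c s x $ A $ B)" for c x
    by (simp add: p_b_def)
  have "odd_components (\<lambda>c x. p_b C c s x / 2)"
    using parity s by (auto simp: parity_conditions_def odd_components_def)
  then show "momentum_parity (\<lambda>i j c x. momentum_lead C i j c s x)"
    using parity s by (auto simp: parity_conditions_def momentum_parity_def even_components_def p)
qed

text \<open>The round metric is independent of time, so the combination formed from the velocities
  is the time derivative of the odd combination formed from the coefficients.\<close>

lemma metric_lead_deriv_parity:
  assumes t: "t \<in> T"
  shows "metric_parity (\<lambda>i j c x. deriv (\<lambda>s. metric_lead C i j c s x) t)"
  unfolding metric_parity_def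
proof (intro conjI allI)
  note parity = metric_lead_parity[unfolded metric_parity_def]
  show "even_components (\<lambda>c x. deriv (\<lambda>s. metric_lead C None None c s x) t)"
    using parity by (intro even_components_deriv[OF open_T t]) blast
  show "odd_components (\<lambda>c x. deriv (\<lambda>s. metric_lead C (Some A) (Some B) c s x) t +
      round_metric c x $ A $ B * deriv (\<lambda>s. metric_lead C None None c s x) t)" for A B
  proof (rule odd_components_deriv[OF open_T t])
    show "odd_components (\<lambda>c x. metric_lead C (Some A) (Some B) c s x + round_metric c x $ A $ B * metric_lead C None None c s x)"
      if "s \<in> T" for s
      using parity that by blast
    show "((\<lambda>s. metric_lead C (Some A) (Some B) c s x + round_metric c x $ A $ B * metric_lead C None None c s x)
        has_real_derivative deriv (\<lambda>s. metric_lead C (Some A) (Some B) c s x) t +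
          round_metric c x $ A $ B * deriv (\<lambda>s. metric_lead C None None c s x) t) (at t)" for c x
      by (intro DERIV_add DERIV_cmult has_real_derivative_lead t)
  qed
qed simp_all

lemma momentum_lead_deriv_parity:
  assumes t: "t \<in> T"
  shows "momentum_parity (\<lambda>i j c x. deriv (\<lambda>s. momentum_lead C i j c s x) t)"
  unfolding momentum_parity_def
proof (intro conjI allI)
  note parity = momentum_lead_parity[unfolded momentum_parity_def]
  show "even_components (\<lambda>c x. deriv (\<lambda>s. momentum_lead C (Some A) (Some B) c s x) t)" for A B
    using parity by (intro even_components_deriv[OF open_T t]) blast
  show "odd_components (\<lambda>c x. deriv (\<lambda>s. momentum_lead C None None c s x) t -
      (\<Sum>A\<in>UNIV. \<Sum>B\<in>UNIV. round_metric c x $ A $ B * deriv (\<lambda>s. momentum_lead C (Some A) (Some B) c s x) t))"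
  proof (rule odd_components_deriv[OF open_T t])
    show "odd_components (\<lambda>c x. momentum_lead C None None c s x -
        (\<Sum>A\<in>UNIV. \<Sum>B\<in>UNIV. round_metric c x $ A $ B * momentum_lead C (Some A) (Some B) c s x))" if "s \<in> T" for s
      using parity that by blast
    show "((\<lambda>s. momentum_lead C None None c s x -
        (\<Sum>A\<in>UNIV. \<Sum>B\<in>UNIV. round_metric c x $ A $ B * momentum_lead C (Some A) (Some B) c s x))
      has_real_derivative deriv (\<lambda>s. momentum_lead C None None c s x) t -
        (\<Sum>A\<in>UNIV. \<Sum>B\<in>UNIV. round_metric c x $ A $ B * deriv (\<lambda>s. momentum_lead C (Some A) (Some B) c s x) t)) (at t)" for c x
      by (intro DERIV_diff DERIV_sum DERIV_cmult has_real_derivative_lead t)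
  qed
qed

section \<open>The coefficient of the logarithm and finiteness\<close>

lemma log_coeff_density_eq_pairing:
  "log_coeff_density C t = (\<lambda>c x.
     \<Sum>i\<in>UNIV. \<Sum>j\<in>UNIV. momentum_lead C i j c t x * deriv (\<lambda>s. metric_lead C i j c s x) t)"
  \<comment> \<open>In the full double sum the mixed terms are multiplied by the derivative of the
    constant 0, leaving the radial and the purely angular terms.\<close>
  by (intro ext) (simp add: log_coeff_density_def sum_option_UNIV)

text \<open>The equality is pointwise on the sphere: the velocity of \<open>k_b\<close> contributes
  the trace of \<open>\<pi>AB_b\<close> times the velocity of \<open>hrr_b\<close>, which cancels
  the trace subtracted in \<open>p_b\<close>.\<close>

lemma log_coeff_density'_eq:
  assumes t: "t \<in> T"
  shows "log_coeff_density' C t = log_coeff_density C t"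
proof (intro ext)
  fix c x
  have rr: "((\<lambda>s. hrr_b C c s x) has_real_derivative deriv (\<lambda>s. hrr_b C c s x) t) (at t)"
    using has_real_derivative_lead(1)[OF t, of None None c x] by simp
  have AB: "((\<lambda>s. hAB_b C c s x $ A $ B) has_real_derivative deriv (\<lambda>s. hAB_b C c s x $ A $ B) t) (at t)" for A B
    using has_real_derivative_lead(1)[OF t, of "Some A" "Some B" c x] by simp
  have lambda: "deriv (\<lambda>s. lambda_b C c s x) t = (1/2) * deriv (\<lambda>s. hrr_b C c s x) t"
    unfolding lambda_b_def by (intro DERIV_imp_deriv DERIV_cmult rr)
  have k: "deriv (\<lambda>s. k_b C c s x $ A $ B) t = (1/2) * deriv (\<lambda>s. hAB_b C c s x $ A $ B) t
      + (1/2) * deriv (\<lambda>s. hrr_b C c s x) t * round_metric c x $ A $ B" for A B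
    unfolding k_b_def lambda_b_def vector_add_component vector_scaleR_component real_scaleR_def
    by (intro DERIV_imp_deriv DERIV_add DERIV_cmult DERIV_cmult_right rr AB)
  show "log_coeff_density' C t c x = log_coeff_density C t c x"
    unfolding log_coeff_density'_def log_coeff_density_def lambda k p_b_def
    by (simp add: UNIV_2 algebra_simps)
qed

lemma sphere_integral_log_coeff_density:
  assumes t: "t \<in> T"
  shows "sphere_integral (log_coeff_density C t) = 0"
  using odd_components_pairing[OF momentum_lead_parity[OF t] metric_lead_deriv_parity[OF t]]
  by (intro sphere_integral_odd) (simp add: log_coeff_density_eq_pairing)

lemma kinetic_density_has_leading:
  assumes t: "t \<in> T"
  shows "has_leading R0 2 (kinetic_density F t) (log_coeff_density C t)"
  unfolding kinetic_density_def[abs_def] log_coeff_density_eq_pairing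
  by (intro has_leading_sum has_leading_mult[OF momentum_has_leading(1) metric_deriv_has_leading metric_momentum_order] t)

end

text \<open>Each of the two terms pairs the momentum velocity of one history with the metric
  velocity of the other. Both histories obey the same parity conditions, so the two leading pairings
  are separately odd and their difference integrates to zero over the sphere.\<close>

lemma symplectic_density_finite:
  assumes F: "boundary_conditions R0 T F C" and G: "boundary_conditions R0 T G D"
    and t: "t \<in> T" and R0: "0 < R0"
  shows "finite_at_infinity R0 (symplectic_density F G t)"
proof -
  interpret F: boundary_conditions R0 T F C by fact
  interpret G: boundary_conditions R0 T G D by fact
  let ?p = "\<lambda>C i j c x. deriv (\<lambda>s. momentum_lead C i j c s x) t"
  let ?h = "\<lambda>C i j c x. deriv (\<lambda>s. metric_lead C i j c s x) t"
  have "has_leading R0 2 (symplectic_density F G t)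
    (\<lambda>c x. \<Sum>i\<in>UNIV. \<Sum>j\<in>UNIV. ?p C i j c x * ?h D i j c x - ?p D i j c x * ?h C i j c x)"
    unfolding symplectic_density_def[abs_def]
    by (intro has_leading_sum has_leading_diff t
        has_leading_mult[OF F.momentum_has_leading(2) G.metric_deriv_has_leading metric_momentum_order]
        has_leading_mult[OF G.momentum_has_leading(2) F.metric_deriv_has_leading metric_momentum_order])
  moreover have "odd_components
    (\<lambda>c x. \<Sum>i\<in>UNIV. \<Sum>j\<in>UNIV. ?p C i j c x * ?h D i j c x - ?p D i j c x * ?h C i j c x)"
    using odd_components_pairing[OF F.momentum_lead_deriv_parity[OF t] G.metric_lead_deriv_parity[OF t]]
      odd_components_pairing[OF G.momentum_lead_deriv_parity[OF t] F.metric_lead_deriv_parity[OF t]]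
    by (simp add: odd_components_def sum_subtractf)
  ultimately show ?thesis
    using has_leading_finite R0 sphere_integral_odd by blast
qed

theorem mainTheorem3:
  fixes R0 :: real and T :: "real set" and F :: fields and C :: coeffs
  assumes "0 < R0" and "open T"
    and "new_boundary_conditions R0 T F C"
  shows "\<forall>t\<in>T.
    sphere_integrable (log_coeff_density C t) \<and>
    sphere_integrable (log_coeff_density' C t) \<and>
    sphere_integral (log_coeff_density C t) = sphere_integral (log_coeff_density' C t) \<and>
    sphere_integral (log_coeff_density' C t) = 0 \<and>
    log_divergence R0 (kinetic_density F t) (sphere_integral (log_coeff_density C t)) \<and>
    finite_at_infinity R0 (kinetic_density F t) \<and>
    (\<forall>G D. new_boundary_conditions R0 T G D \<and> agree_at R0 t F G \<longrightarrow>
       finite_at_infinity R0 (symplectic_density F G t))"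
proof
  fix t assume t: "t \<in> T"
  interpret boundary_conditions R0 T F C
    using assms by unfold_locales
  have "sphere_integrable (log_coeff_density C t)"
    using kinetic_density_has_leading[OF t] by (intro sphere_integrable_continuous) (simp add: has_leading_def)
  moreover have "log_divergence R0 (kinetic_density F t) (sphere_integral (log_coeff_density C t))"
    by (rule has_leading_log_divergence[OF kinetic_density_has_leading[OF t] \<open>0 < R0\<close>])
  moreover have "finite_at_infinity R0 (kinetic_density F t)"
    by (rule has_leading_finite[OF kinetic_density_has_leading[OF t] \<open>0 < R0\<close> sphere_integral_log_coeff_density[OF t]])
  moreover have "finite_at_infinity R0 (symplectic_density F G t)" if "new_boundary_conditions R0 T G D" for G D
    using symplectic_density_finite[OF boundary_conditions_axioms boundary_conditions.intro[OF open_T that] t \<open>0 < R0\<close>] .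
  ultimately show "sphere_integrable (log_coeff_density C t) \<and>
    sphere_integrable (log_coeff_density' C t) \<and>
    sphere_integral (log_coeff_density C t) = sphere_integral (log_coeff_density' C t) \<and>
    sphere_integral (log_coeff_density' C t) = 0 \<and>
    log_divergence R0 (kinetic_density F t) (sphere_integral (log_coeff_density C t)) \<and>
    finite_at_infinity R0 (kinetic_density F t) \<and>
    (\<forall>G D. new_boundary_conditions R0 T G D \<and> agree_at R0 t F G \<longrightarrow>
       finite_at_infinity R0 (symplectic_density F G t))"
    using log_coeff_density'_eq[OF t] sphere_integral_log_coeff_density[OF t] by auto
qed

end
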